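(* Let $q$ be a non-zero complex number with $|q|\neq 1$. (1) If $q$ is non-real and $\theta=\frac{1}{\pi}\arg(q)$ is irrational, then the center of $\mathcal{O}(U_q(2))$ is trivial, i.e. equal to $\mathbb{C}\cdot 1$. (2) If $q$ is real, then the center of $\mathcal{O}(U_q(2))$ is non-trivial, i.e. strictly larger than $\mathbb{C}\cdot 1$.
   Context: For a non-zero complex number $q$, $C(U_q(2))$ denotes the universal unital $C^*$-algebra generated by elements $a,b,D$ satisfying the relations $$ba=q\,ab,\quad a^*b=q\,ba^*,\quad bb^*=b^*b,\quad aa^*+bb^*=1,$$ $$aD=Da,\quad bD=q^2|q|^{-2}Db,\quad DD^*=D^*D=1,\quad a^*a+|q|^2b^*b=1.$$ $\mathcal{O}(U_q(2))$ denotes the (unital, not completed) $*$-subalgebra of $C(U_q(2))$ generated by $a,b,D$. *)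

theory Defs
  imports
    "HOL-Analysis.Analysis"
    "HOL-Algebra.Ring"
    "HOL-Library.Poly_Mapping"
begin

section \<open>The free unital complex *-algebra on a set of generators\<close>

text \<open>
  A letter \<open>(g, False)\<close> stands for the generator \<open>g\<close> and \<open>(g, True)\<close> for its adjoint.  Words form
  the free monoid, written additively, so that the convolution product of \<open>Poly_Mapping\<close> turns
  finitely supported functions on words into the free unital algebra on the letters.
\<close>

datatype 'g star_word = Word (letters: "('g \<times> bool) list")

instantiation star_word :: (type) monoid_add
begin

definition zero_star_word :: "'a star_word" where
  "0 = Word []"

definition plus_star_word :: "'a star_word \<Rightarrow> 'a star_word \<Rightarrow> 'a star_word" where
  "u + v = Word (letters u @ letters v)"

instance
  by standard (simp_all add: zero_star_word_def plus_star_word_def)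

end

type_synonym 'g free_star_algebra = "'g star_word \<Rightarrow>\<^sub>0 complex"

definition adj_word :: "'g star_word \<Rightarrow> 'g star_word" where
  "adj_word w = Word (rev (map (\<lambda>(g, s). (g, \<not> s)) (letters w)))"

definition fstar :: "'g free_star_algebra \<Rightarrow> 'g free_star_algebra" where
  "fstar x =
     (\<Sum>w\<in>Poly_Mapping.keys x. Poly_Mapping.single (adj_word w) (cnj (Poly_Mapping.lookup x w)))"

definition fconst :: "complex \<Rightarrow> 'g free_star_algebra" where
  "fconst c = Poly_Mapping.single 0 c"

definition fgen :: "'g \<Rightarrow> 'g free_star_algebra" where
  "fgen g = Poly_Mapping.single (Word [(g, False)]) 1"


section \<open>The universal unital C*-algebra of a set of relations\<close>

text \<open>
  A relation \<open>l = r\<close> is given by the element \<open>l - r\<close> of the free *-algebra.  The C*-seminorms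
  killing all relations are exactly the functions \<open>x \<mapsto> \<parallel>\<pi> x\<parallel>\<close>, where \<open>\<pi>\<close> is the unital
  *-homomorphism given by elements of some unital C*-algebra (of arbitrary size, possibly zero)
  satisfying the relations.  The universal C*-algebra is the Hausdorff completion of the
  free *-algebra with respect to their supremum.
\<close>

definition cstar_seminorm :: "('g free_star_algebra \<Rightarrow> real) \<Rightarrow> bool" where
  "cstar_seminorm p \<longleftrightarrow>
     (\<forall>x. 0 \<le> p x) \<and>
     (\<forall>x y. p (x + y) \<le> p x + p y) \<and>
     (\<forall>c x. p (fconst c * x) = cmod c * p x) \<and>
     (\<forall>x y. p (x * y) \<le> p x * p y) \<and>
     (\<forall>x. p (fstar x * x) = (p x)\<^sup>2)"

definition rel_seminorms ::
    "'g free_star_algebra set \<Rightarrow> ('g free_star_algebra \<Rightarrow> real) set" where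
  "rel_seminorms R = {p. cstar_seminorm p \<and> (\<forall>r\<in>R. p r = 0)}"

text \<open>
  The supremum is meaningful when the set is bounded above for every \<open>x\<close> (equivalently, for
  the generators), which is the usual condition for the universal C*-algebra to exist; see
  \<open>uq2_seminorms_bdd\<close> below for the relations of interest.
\<close>

definition univ_seminorm :: "'g free_star_algebra set \<Rightarrow> 'g free_star_algebra \<Rightarrow> real" where
  "univ_seminorm R x = (SUP p\<in>rel_seminorms R. p x)"

definition cauchy_seqs :: "'g free_star_algebra set \<Rightarrow> (nat \<Rightarrow> 'g free_star_algebra) set" where
  "cauchy_seqs R =
     {X. \<forall>e>0. \<exists>N. \<forall>m\<ge>N. \<forall>n\<ge>N. univ_seminorm R (X m - X n) < e}"

definition null_rel ::
    "'g free_star_algebra set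
       \<Rightarrow> ((nat \<Rightarrow> 'g free_star_algebra) \<times> (nat \<Rightarrow> 'g free_star_algebra)) set" where
  "null_rel R =
     {(X, Y). X \<in> cauchy_seqs R \<and> Y \<in> cauchy_seqs R \<and>
              (\<lambda>n. univ_seminorm R (X n - Y n)) \<longlonglongrightarrow> 0}"

record 'a star_algebra = "'a ring" +
  scale :: "complex \<Rightarrow> 'a \<Rightarrow> 'a"
  star :: "'a \<Rightarrow> 'a"
  cnorm :: "'a \<Rightarrow> real"

type_synonym 'g completion = "(nat \<Rightarrow> 'g free_star_algebra) set"

definition universal_cstar_algebra ::
    "'g free_star_algebra set \<Rightarrow> 'g completion star_algebra" where
  "universal_cstar_algebra R =
     \<lparr> carrier = cauchy_seqs R // null_rel R,
       mult = (\<lambda>U V. \<Union>X\<in>U. \<Union>Y\<in>V. null_rel R `` {\<lambda>n. X n * Y n}),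
       one = null_rel R `` {\<lambda>n. 1},
       zero = null_rel R `` {\<lambda>n. 0},
       add = (\<lambda>U V. \<Union>X\<in>U. \<Union>Y\<in>V. null_rel R `` {\<lambda>n. X n + Y n}),
       scale = (\<lambda>c U. \<Union>X\<in>U. null_rel R `` {\<lambda>n. fconst c * X n}),
       star = (\<lambda>U. \<Union>X\<in>U. null_rel R `` {\<lambda>n. fstar (X n)}),
       cnorm = (\<lambda>U. THE r. \<forall>X\<in>U. (\<lambda>n. univ_seminorm R (X n)) \<longlonglongrightarrow> r) \<rparr>"

definition univ_gen :: "'g free_star_algebra set \<Rightarrow> 'g \<Rightarrow> 'g completion" where
  "univ_gen R g = null_rel R `` {\<lambda>n. fgen g}"


section \<open>Generated *-subalgebras and centers\<close>

definition star_subalgebra :: "('a, 'b) star_algebra_scheme \<Rightarrow> 'a set \<Rightarrow> bool" where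
  "star_subalgebra A S \<longleftrightarrow>
     S \<subseteq> carrier A \<and> \<one>\<^bsub>A\<^esub> \<in> S \<and>
     (\<forall>x\<in>S. \<forall>y\<in>S. x \<oplus>\<^bsub>A\<^esub> y \<in> S \<and> x \<otimes>\<^bsub>A\<^esub> y \<in> S) \<and>
     (\<forall>c. \<forall>x\<in>S. scale A c x \<in> S) \<and>
     (\<forall>x\<in>S. star A x \<in> S)"

definition generated_star_subalgebra ::
    "('a, 'b) star_algebra_scheme \<Rightarrow> 'a set \<Rightarrow> ('a, 'b) star_algebra_scheme" where
  "generated_star_subalgebra A G = A\<lparr>carrier := \<Inter>{S. star_subalgebra A S \<and> G \<subseteq> S}\<rparr>"

definition algebra_center :: "('a, 'b) star_algebra_scheme \<Rightarrow> 'a set" where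
  "algebra_center A = {z \<in> carrier A. \<forall>x\<in>carrier A. z \<otimes>\<^bsub>A\<^esub> x = x \<otimes>\<^bsub>A\<^esub> z}"

definition algebra_scalars :: "('a, 'b) star_algebra_scheme \<Rightarrow> 'a set" where
  "algebra_scalars A = range (\<lambda>c. scale A c \<one>\<^bsub>A\<^esub>)"


section \<open>The quantum group \<open>U\<^sub>q(2)\<close>\<close>

datatype uq2_gen = Gen_a | Gen_b | Gen_D

definition uq2_relations :: "complex \<Rightarrow> uq2_gen free_star_algebra set" where
  "uq2_relations q =
     (let a = fgen Gen_a; b = fgen Gen_b; D = fgen Gen_D in
      { b * a - fconst q * (a * b),
        fstar a * b - fconst q * (b * fstar a),
        b * fstar b - fstar b * b,
        a * fstar a + b * fstar b - 1,
        a * D - D * a,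
        b * D - fconst (q\<^sup>2 / of_real ((cmod q)\<^sup>2)) * (D * b),
        D * fstar D - 1,
        fstar D * D - 1,
        fstar a * a + fconst (of_real ((cmod q)\<^sup>2)) * (fstar b * b) - 1 })"

definition C_Uq2 :: "complex \<Rightarrow> uq2_gen completion star_algebra" where
  "C_Uq2 q = universal_cstar_algebra (uq2_relations q)"

definition O_Uq2 :: "complex \<Rightarrow> uq2_gen completion star_algebra" where
  "O_Uq2 q =
     generated_star_subalgebra (C_Uq2 q)
       {univ_gen (uq2_relations q) Gen_a,
        univ_gen (uq2_relations q) Gen_b,
        univ_gen (uq2_relations q) Gen_D}"


subsection \<open>The supremum defining the norm of \<open>C(U\<^sub>q(2))\<close> is finite\<close>

lemma fstar_single: "fstar (Poly_Mapping.single w c) = Poly_Mapping.single (adj_word w) (cnj c)"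
  by (simp add: fstar_def)

lemma fstar_fstar_fgen: "fstar (fstar (fgen g)) = fgen g"
  by (simp add: fstar_single fgen_def adj_word_def)

lemma fstar_one: "fstar 1 = (1 :: 'g free_star_algebra)"
proof -
  have "adj_word 0 = (0 :: 'g star_word)" by (simp add: adj_word_def zero_star_word_def)
  then show ?thesis using fstar_single[of "0 :: 'g star_word" 1] by simp
qed

lemma fconst_one: "fconst 1 = 1"
  by (simp add: fconst_def)

lemma fconst_diff: "fconst (c - d) = fconst c - fconst d"
  by (simp add: fconst_def single_diff)

lemma single_Word_Cons:
  "Poly_Mapping.single (Word ((g, s) # us)) c =
     (if s then fstar (fgen g) else fgen g) * Poly_Mapping.single (Word us) c"
  by (simp add: fgen_def fstar_single mult_single plus_star_word_def adj_word_def)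

lemma poly_mapping_sum_single:
  "x = (\<Sum>w\<in>Poly_Mapping.keys x. Poly_Mapping.single w (Poly_Mapping.lookup x w))"
  by (rule poly_mapping_eqI) (simp add: lookup_sum lookup_single when_def in_keys_iff)

context
  fixes p :: "'g free_star_algebra \<Rightarrow> real"
  assumes p: "cstar_seminorm p"
begin

private lemma seminorm_rules:
  "0 \<le> p x" "p (x + y) \<le> p x + p y" "p (fconst c * x) = cmod c * p x"
  "p (x * y) \<le> p x * p y" "p (fstar x * x) = (p x)\<^sup>2"
  using p by (simp_all add: cstar_seminorm_def)

lemma cstar_seminorm_zero: "p 0 = 0"
  using seminorm_rules(3)[of 0 0] by simp

lemma cstar_seminorm_uminus: "p (- x) = p x"
  using seminorm_rules(3)[of "-1" x] fconst_diff[of 0 1] by (simp add: fconst_def single_uminus)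

lemma cstar_seminorm_diff: "p (x - y) \<le> p x + p y"
  using seminorm_rules(2)[of x "- y"] cstar_seminorm_uminus[of y] by simp

lemma cstar_seminorm_eq_if_diff: assumes "p (x - y) = 0" shows "p x = p y"
  using seminorm_rules(2)[of "x - y" y] seminorm_rules(2)[of "y - x" x]
    cstar_seminorm_uminus[of "x - y"] assms by simp

lemma cstar_seminorm_sum: "p (sum f A) \<le> (\<Sum>i\<in>A. p (f i))"
proof (induction A rule: infinite_finite_induct)
  case (insert i A)
  then show ?case using seminorm_rules(2)[of "f i" "sum f A"] by simp
qed (simp_all add: cstar_seminorm_zero)

lemma cstar_seminorm_one_le: "p 1 \<le> 1"
proof -
  have "p 1 * p 1 = p 1 * 1" using seminorm_rules(5)[of 1] by (simp add: fstar_one power2_eq_square)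
  then show ?thesis by (metis mult_cancel_left order_refl zero_le_one)
qed

lemma cstar_seminorm_fstar_fgen: "p (fstar (fgen g)) = p (fgen g)"
proof -
  have *: "s \<le> t" if "s\<^sup>2 \<le> t * s" "0 \<le> s" "0 \<le> t" for s t :: real
    using that by (cases "s = 0") (auto simp: power2_eq_square)
  have "(p (fgen g))\<^sup>2 \<le> p (fstar (fgen g)) * p (fgen g)"
    using seminorm_rules(4)[of "fstar (fgen g)" "fgen g"] seminorm_rules(5)[of "fgen g"] by simp
  moreover have "(p (fstar (fgen g)))\<^sup>2 \<le> p (fgen g) * p (fstar (fgen g))"
    using seminorm_rules(4)[of "fgen g" "fstar (fgen g)"] seminorm_rules(5)[of "fstar (fgen g)"]
    by (simp add: fstar_fstar_fgen)
  ultimately show ?thesis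
    using *[of "p (fgen g)" "p (fstar (fgen g))"] *[of "p (fstar (fgen g))" "p (fgen g)"]
      seminorm_rules(1) by simp
qed

lemma cstar_seminorm_fgen_fstar: "p (fgen g * fstar (fgen g)) = (p (fgen g))\<^sup>2"
  using seminorm_rules(5)[of "fstar (fgen g)"]
  by (simp add: fstar_fstar_fgen cstar_seminorm_fstar_fgen)

lemma cstar_seminorm_le_if_gens:
  assumes gens: "\<And>g. p (fgen g) \<le> B" and "0 \<le> B"
  shows "p x \<le> (\<Sum>w\<in>Poly_Mapping.keys x. cmod (Poly_Mapping.lookup x w) * B ^ length (letters w))"
proof -
  have word: "p (Poly_Mapping.single (Word us) 1) \<le> B ^ length us" for us
  proof (induction us)
    case Nil
    show ?case using cstar_seminorm_one_le by (simp flip: zero_star_word_def)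
  next
    case (Cons u us)
    obtain g s where u: "u = (g, s)" by force
    have "p (Poly_Mapping.single (Word (u # us)) 1)
            \<le> p (if s then fstar (fgen g) else fgen g) * p (Poly_Mapping.single (Word us) 1)"
      unfolding u single_Word_Cons by (rule seminorm_rules)
    also have "\<dots> \<le> B * B ^ length us"
      using Cons gens[of g] \<open>0 \<le> B\<close>
      by (intro mult_mono) (auto simp: cstar_seminorm_fstar_fgen seminorm_rules)
    finally show ?case by simp
  qed
  have mon: "p (Poly_Mapping.single w c) \<le> cmod c * B ^ length (letters w)" for w c
  proof -
    have "Poly_Mapping.single w c = fconst c * Poly_Mapping.single w 1"
      by (simp add: fconst_def mult_single)
    then have "p (Poly_Mapping.single w c) = cmod c * p (Poly_Mapping.single w 1)"
      by (simp add: seminorm_rules)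
    also have "\<dots> \<le> cmod c * B ^ length (letters w)"
      using word[of "letters w"] by (intro mult_left_mono) auto
    finally show ?thesis .
  qed
  have "p x = p (\<Sum>w\<in>Poly_Mapping.keys x. Poly_Mapping.single w (Poly_Mapping.lookup x w))"
    by (rule arg_cong[OF poly_mapping_sum_single])
  also have "\<dots> \<le> (\<Sum>w\<in>Poly_Mapping.keys x.
                      p (Poly_Mapping.single w (Poly_Mapping.lookup x w)))"
    by (rule cstar_seminorm_sum)
  also have "\<dots> \<le> (\<Sum>w\<in>Poly_Mapping.keys x.
                      cmod (Poly_Mapping.lookup x w) * B ^ length (letters w))"
    by (intro sum_mono mon)
  finally show ?thesis .
qed

end

lemma uq2_seminorm_fgen_le:
  assumes "p \<in> rel_seminorms (uq2_relations q)" "q \<noteq> 0" "cmod q \<noteq> 1"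
  shows "p (fgen g) \<le> 2"
proof -
  define a b D :: "uq2_gen free_star_algebra"
    where "a = fgen Gen_a" and "b = fgen Gen_b" and "D = fgen Gen_D"
  define Q where "Q = (cmod q)\<^sup>2"
  have p: "cstar_seminorm p"
    and rel: "\<And>r. r \<in> uq2_relations q \<Longrightarrow> p r = 0"
    using assms(1) by (auto simp: rel_seminorms_def)
  have scl: "p (fconst c * x) = cmod c * p x" and tri: "p (x + y) \<le> p x + p y"
    and star: "p (fstar x * x) = (p x)\<^sup>2" and nonneg: "0 \<le> p x" for c x y
    using p by (simp_all add: cstar_seminorm_def)
  note eq = cstar_seminorm_eq_if_diff[OF p]
  have Q: "0 < Q" "Q \<noteq> 1"
    using assms(2,3) norm_ge_zero[of q] by (auto simp: Q_def power2_eq_1_iff simp del: norm_ge_zero)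
  have bb: "p (b * fstar b - fstar b * b) = 0" by (rule rel) (unfold uq2_relations_def Let_def b_def, blast)
  have sum1: "p (a * fstar a + b * fstar b - 1) = 0"
    by (rule rel) (unfold uq2_relations_def Let_def a_def b_def, blast)
  have sum2: "p (fstar a * a + fconst (of_real Q) * (fstar b * b) - 1) = 0"
    by (rule rel) (unfold uq2_relations_def Let_def a_def b_def Q_def, blast)
  have DD: "p (fstar D * D - 1) = 0" by (rule rel) (unfold uq2_relations_def Let_def D_def, blast)
  define y where "y = fstar b * b"
  have r1: "p (1 - y) = (p a)\<^sup>2"
  proof -
    have "p ((1 - y) - a * fstar a) = p ((b * fstar b - fstar b * b) - (a * fstar a + b * fstar b - 1))"
      by (simp add: y_def algebra_simps)
    also have "\<dots> \<le> 0"
      using cstar_seminorm_diff[OF p, of "b * fstar b - fstar b * b" "a * fstar a + b * fstar b - 1"]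
        bb sum1 by simp
    finally have "p ((1 - y) - a * fstar a) = 0" using nonneg by (simp add: antisym)
    from eq[OF this] show ?thesis
      using cstar_seminorm_fgen_fstar[OF p, of Gen_a] by (simp add: a_def)
  qed
  have r2: "p (1 - fconst (of_real Q) * y) = (p a)\<^sup>2"
  proof -
    have "p ((1 - fconst (of_real Q) * y) - fstar a * a)
            = p (- (fstar a * a + fconst (of_real Q) * (fstar b * b) - 1))"
      by (simp add: y_def algebra_simps)
    also have "\<dots> = 0" using sum2 by (simp only: cstar_seminorm_uminus[OF p])
    finally show ?thesis using eq[of "1 - fconst (of_real Q) * y" "fstar a * a"] star by simp
  qed
  have fc: "fconst c * fconst d = fconst (c * d)" for c d by (simp add: fconst_def mult_single)
  have conv: "p (1 - fconst (of_real s) * z) \<le> (1 - s) + s * p (1 - z)"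
    if "0 < s" "s < 1" for s z
  proof -
    have "1 - fconst (of_real s) * z = fconst (of_real (1 - s)) * 1 + fconst (of_real s) * (1 - z)"
      by (simp add: algebra_simps fconst_diff fconst_one)
    then have "p (1 - fconst (of_real s) * z)
                 \<le> p (fconst (of_real (1 - s)) * 1) + p (fconst (of_real s) * (1 - z))"
      using tri by metis
    also have "\<dots> = (1 - s) * p 1 + s * p (1 - z)"
      unfolding scl norm_of_real using that by (simp only: abs_of_pos diff_gt_0_iff_gt)
    also have "\<dots> \<le> (1 - s) * 1 + s * p (1 - z)"
      using cstar_seminorm_one_le[OF p] that by (intro add_right_mono mult_left_mono) auto
    finally show ?thesis by simp
  qed
  have ra: "(p a)\<^sup>2 \<le> 1"
  proof (cases "Q < 1")
    case True
    then have "(1 - Q) * (p a)\<^sup>2 \<le> (1 - Q) * 1"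
      using conv[of Q y] Q r1 r2 by (simp add: algebra_simps)
    then show ?thesis using True by simp
  next
    case False
    then have s: "0 < 1 / Q" "1 / Q < 1" using Q by auto
    have "fconst (of_real (1 / Q)) * (fconst (of_real Q) * y) = y"
      using Q by (simp add: fc fconst_one flip: mult.assoc of_real_mult)
    then have "(1 - 1 / Q) * (p a)\<^sup>2 \<le> (1 - 1 / Q) * 1"
      using conv[OF s, of "fconst (of_real Q) * y"] r1 r2 by (simp add: algebra_simps)
    then show ?thesis using s by (metis diff_gt_0_iff_gt mult_le_cancel_left_pos)
  qed
  have "(p b)\<^sup>2 = p (1 - (1 - y))" using star[of b] by (simp add: y_def)
  also have "\<dots> \<le> 2"
    using cstar_seminorm_diff[OF p, of 1 "1 - y"] cstar_seminorm_one_le[OF p] r1 ra by simp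
  finally have rb: "(p b)\<^sup>2 \<le> 2" .
  have rD: "(p D)\<^sup>2 \<le> 1"
    using eq[OF DD] star[of D] cstar_seminorm_one_le[OF p] by simp
  have "(p (fgen g))\<^sup>2 \<le> 2\<^sup>2"
    using ra rb rD by (cases g) (simp_all add: a_def b_def D_def)
  then show ?thesis by (rule power2_le_imp_le) simp
qed

lemma uq2_seminorms_bdd:
  assumes "q \<noteq> 0" "cmod q \<noteq> 1"
  shows "bdd_above ((\<lambda>p. p x) ` rel_seminorms (uq2_relations q))"
proof (rule bdd_aboveI2)
  fix p assume "p \<in> rel_seminorms (uq2_relations q)"
  then show "p x \<le> (\<Sum>w\<in>Poly_Mapping.keys x.
                       cmod (Poly_Mapping.lookup x w) * 2 ^ length (letters w))"
    using uq2_seminorm_fgen_le[OF _ assms]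
    by (intro cstar_seminorm_le_if_gens) (auto simp: rel_seminorms_def)
qed

end

theory Submission
  imports Defs "HOL-Computational_Algebra.Polynomial"
begin

text \<open>
  Modulo the relations every word of degree \<open>(k, j, l)\<close> in \<open>(a, b, D)\<close> is a polynomial in
  \<open>y = b b\<^sup>*\<close> times the normal word \<open>b\<^sup>j a\<^sup>k D\<^sup>l\<close> (negative exponents standing for powers of the
  adjoints).  The algebra acts by weighted shifts: with \<open>Q = \<bar>q\<bar>\<^sup>2\<close> and \<open>\<lambda> = q\<^sup>2 / \<bar>q\<bar>\<^sup>2\<close>,
  \<open>a\<close> maps \<open>e(n, r, s)\<close> to \<open>sqrt (1 - Q\<^bsup>n+1\<^esup>) e(n + 1, r, s)\<close>, \<open>b\<close> maps it to
  \<open>q\<^sup>n e(n, r + 1, s)\<close> and \<open>D\<close> to \<open>\<lambda>\<^bsup>-r\<^esup> e(n, r, s + 1)\<close>, where \<open>n \<ge> 0\<close> if \<open>\<bar>q\<bar> < 1\<close> and \<open>n < 0\<close>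
  otherwise.  Finitely supported vectors suffice, since the C*-identity of the operator norm only
  needs adjoints and the Cauchy-Schwarz inequality.  Different degrees act by different shifts and
  \<open>y\<close> has the infinitely many eigenvalues \<open>Q\<^sup>n\<close>, so an element that acts as zero is zero.  Comparing
  matrix entries, a central element commutes with \<open>D\<close> only if \<open>\<lambda>\<^sup>j = 1\<close>, with \<open>b\<close> only if
  \<open>q\<^sup>k = \<lambda>\<^bsup>-l\<^esup>\<close>, hence (taking moduli) \<open>k = 0\<close> and \<open>\<lambda>\<^sup>l = 1\<close>, and with \<open>a\<close> only if its degree-zero
  part is constant in \<open>n\<close>.  For real \<open>q\<close> we have \<open>\<lambda> = 1\<close>, and \<open>D\<close> is central.
\<close>


section \<open>The free *-algebra\<close>

lemma poly_mapping_induct_single [case_names single add]: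
  assumes "\<And>w c. P (Poly_Mapping.single w c)" and "\<And>x y. P x \<Longrightarrow> P y \<Longrightarrow> P (x + y)"
  shows "P (x :: 'a \<Rightarrow>\<^sub>0 complex)"
proof -
  have "P (\<Sum>w\<in>A. Poly_Mapping.single w (Poly_Mapping.lookup x w))" for A
  proof (induction A rule: infinite_finite_induct)
    case (insert w A)
    then show ?case using assms by simp
  qed (use assms(1)[of undefined 0] in simp_all)
  moreover have "x = (\<Sum>w\<in>Poly_Mapping.keys x. Poly_Mapping.single w (Poly_Mapping.lookup x w))"
    by (rule poly_mapping_eqI) (simp add: lookup_sum lookup_single when_def in_keys_iff)
  ultimately show ?thesis by metis
qed

lemma fconst_mult: "fconst c * fconst d = fconst (c * d)"
  by (simp add: fconst_def mult_single)

lemma fconst_add: "fconst (c + d) = fconst c + fconst d"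
  by (simp add: fconst_def single_add)

lemma fconst_0: "fconst 0 = 0"
  by (simp add: fconst_def)

lemma fconst_commute: "x * fconst c = fconst c * x"
  by (induction x rule: poly_mapping_induct_single)
    (simp_all add: fconst_def mult_single mult.commute algebra_simps)

lemma fconst_left_commute: "x * (fconst c * y) = fconst c * (x * y)"
  by (metis fconst_commute mult.assoc)

lemma adj_word_adj_word: "adj_word (adj_word w) = w"
  by (cases w) (simp add: adj_word_def rev_map comp_def case_prod_beta)

lemma adj_word_plus: "adj_word (u + v) = adj_word v + adj_word u"
  by (simp add: adj_word_def plus_star_word_def)

text \<open>Since \<open>adj_word\<close> is an involution, exactly one word contributes to each
  coefficient; the algebraic laws of \<open>fstar\<close> then become pointwise checks.\<close>

lemma lookup_fstar: "Poly_Mapping.lookup (fstar x) w = cnj (Poly_Mapping.lookup x (adj_word w))"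
proof -
  have "Poly_Mapping.lookup (fstar x) w =
      (\<Sum>v\<in>Poly_Mapping.keys x. if v = adj_word w then cnj (Poly_Mapping.lookup x v) else 0)"
    unfolding fstar_def lookup_sum
    by (intro sum.cong) (auto simp: lookup_single when_def adj_word_adj_word)
  then show ?thesis by (simp add: in_keys_iff)
qed

lemma fstar_add: "fstar (x + y) = fstar x + fstar y"
  by (rule poly_mapping_eqI) (simp add: lookup_fstar lookup_add)

lemma fstar_diff: "fstar (x - y) = fstar x - fstar y"
  by (rule poly_mapping_eqI) (simp add: lookup_fstar lookup_minus)

lemma fstar_fstar: "fstar (fstar x) = x"
  by (rule poly_mapping_eqI) (simp add: lookup_fstar adj_word_adj_word)

lemma fstar_mult: "fstar (x * y) = fstar y * fstar x"
proof (induction x rule: poly_mapping_induct_single)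
  case (single w c)
  show ?case
    by (induction y rule: poly_mapping_induct_single)
      (simp_all add: fstar_single mult_single adj_word_plus algebra_simps fstar_add)
qed (simp add: algebra_simps fstar_add)

lemma fstar_fconst: "fstar (fconst c) = fconst (cnj c)"
  by (simp add: fconst_def fstar_single adj_word_def zero_star_word_def)

lemma fconst_times_single: "fconst c * Poly_Mapping.single w d = Poly_Mapping.single w (c * d)"
  by (simp add: fconst_def mult_single)

text \<open>Words are peeled from the left, one letter at a time, and linear combinations do the
  rest. This form serves for generation by the generators and for the centrality of
  \<open>D\<close>.\<close>

lemma free_star_algebra_induct [case_names one gen star_gen add scale]:
  assumes "P 1" and "\<And>g x. P x \<Longrightarrow> P (fgen g * x)" and "\<And>g x. P x \<Longrightarrow> P (fstar (fgen g) * x)"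
    and "\<And>x y. P x \<Longrightarrow> P y \<Longrightarrow> P (x + y)" and "\<And>c x. P x \<Longrightarrow> P (fconst c * x)"
  shows "P x"
proof (induction x rule: poly_mapping_induct_single)
  case (single w c)
  obtain us where w: "w = Word us" by (cases w)
  have "P (Poly_Mapping.single (Word us) 1)"
  proof (induction us)
    case Nil
    then show ?case using assms(1) by (simp flip: zero_star_word_def)
  next
    case (Cons u us)
    then show ?case using assms(2,3) by (cases u) (simp add: single_Word_Cons)
  qed
  from assms(5)[OF this, of c] show ?case by (simp add: w fconst_times_single)
qed (use assms(4) in blast)


section \<open>The universal seminorm and the completion\<close>

text \<open>The C*-identity with submultiplicativity gives
  \<open>(p x)^2 <= p (fstar x) * p x\<close>; cancelling \<open>p x\<close> gives one inequality,
  and \<open>fstar x\<close> in place of \<open>x\<close> the other.\<close>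

lemma cstar_seminorm_fstar:
  assumes p: "cstar_seminorm p"
  shows "p (fstar x) = p x"
proof -
  have le: "p x \<le> p (fstar x)" for x
  proof -
    have "p x * p x \<le> p (fstar x) * p x" and nn: "0 \<le> p x" "0 \<le> p (fstar x)"
      using p unfolding cstar_seminorm_def power2_eq_square by metis+
    then show ?thesis by (metis mult_right_le_imp_le order_le_less)
  qed
  from le[of x] le[of "fstar x"] show ?thesis by (simp add: fstar_fstar)
qed

locale star_relations =
  fixes R :: "'g free_star_algebra set"
  assumes bdd: "\<And>x. bdd_above ((\<lambda>p. p x) ` rel_seminorms R)"
begin

abbreviation us :: "'g free_star_algebra \<Rightarrow> real" where
  "us \<equiv> univ_seminorm R"

text \<open>Makes the set of seminorms nonempty, so that together with \<open>bdd\<close> the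
  supremum defining \<open>us\<close> is a genuine least upper bound.\<close>

lemma rel_seminorms_zero: "(\<lambda>_. 0) \<in> rel_seminorms R"
  by (simp add: rel_seminorms_def cstar_seminorm_def)

lemma us_upper: "p \<in> rel_seminorms R \<Longrightarrow> p x \<le> us x"
  unfolding univ_seminorm_def by (rule cSUP_upper[OF _ bdd])

lemma us_least: "(\<And>p. p \<in> rel_seminorms R \<Longrightarrow> p x \<le> M) \<Longrightarrow> us x \<le> M"
  unfolding univ_seminorm_def by (rule cSUP_least) (use rel_seminorms_zero in auto)

lemma rel_seminormsD:
  assumes "p \<in> rel_seminorms R"
  shows "cstar_seminorm p" "0 \<le> p x" "p (x + y) \<le> p x + p y" "p (fconst c * x) = cmod c * p x"
    "p (x * y) \<le> p x * p y" "p (fstar x * x) = (p x)\<^sup>2" "r \<in> R \<Longrightarrow> p r = 0"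
    "p (fstar x) = p x"
  using assms cstar_seminorm_fstar[of p x] by (simp_all add: rel_seminorms_def cstar_seminorm_def)

lemma us_nonneg: "0 \<le> us x"
  using us_upper[OF rel_seminorms_zero] .

lemma us_zero_iff: "us x = 0 \<longleftrightarrow> (\<forall>p\<in>rel_seminorms R. p x = 0)"
proof
  assume "us x = 0"
  then show "\<forall>p\<in>rel_seminorms R. p x = 0"
    using us_upper[of _ x] rel_seminormsD(2)[of _ x] by (simp add: order_antisym)
next
  assume "\<forall>p\<in>rel_seminorms R. p x = 0"
  then have "us x \<le> 0" by (intro us_least) (metis order_refl)
  then show "us x = 0" using us_nonneg[of x] by simp
qed

lemma us_add: "us (x + y) \<le> us x + us y"
proof (rule us_least)
  fix p assume p: "p \<in> rel_seminorms R"
  show "p (x + y) \<le> us x + us y"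
    using rel_seminormsD(3)[OF p, of x y] us_upper[OF p, of x] us_upper[OF p, of y] by linarith
qed

lemma us_mult: "us (x * y) \<le> us x * us y"
proof (rule us_least)
  fix p assume p: "p \<in> rel_seminorms R"
  have "p (x * y) \<le> p x * p y" by (rule rel_seminormsD(5)[OF p])
  also have "\<dots> \<le> us x * us y"
    by (intro mult_mono us_upper p us_nonneg rel_seminormsD)
  finally show "p (x * y) \<le> us x * us y" .
qed

lemma us_scale: "us (fconst c * x) \<le> cmod c * us x"
proof (rule us_least)
  fix p assume p: "p \<in> rel_seminorms R"
  show "p (fconst c * x) \<le> cmod c * us x"
    using rel_seminormsD(4)[OF p, of c x] us_upper[OF p, of x] by (simp add: mult_left_mono)
qed

lemma us_fstar: "us (fstar x) = us x"
proof -
  have "us (fstar x) \<le> us x" for x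
    by (rule us_least) (simp add: rel_seminormsD(8) us_upper)
  from this[of x] this[of "fstar x"] show ?thesis by (simp add: fstar_fstar)
qed

lemma us_zero: "us 0 = 0"
  by (simp add: us_zero_iff cstar_seminorm_zero rel_seminormsD(1))

lemma us_minus_commute: "us (x - y) = us (y - x)"
proof -
  have "us (- x) \<le> us x" for x
    by (rule us_least) (simp add: cstar_seminorm_uminus rel_seminormsD(1) us_upper)
  from this[of "x - y"] this[of "y - x"] show ?thesis by simp
qed

lemma us_diff_triangle: "us (x - z) \<le> us (x - y) + us (y - z)"
  using us_add[of "x - y" "y - z"] by simp

section \<open>Equality in the Hausdorff quotient of the free algebra\<close>

definition eqv :: "'g free_star_algebra \<Rightarrow> 'g free_star_algebra \<Rightarrow> bool" (infix "\<doteq>" 50) where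
  "x \<doteq> y \<longleftrightarrow> us (x - y) = 0"

lemma eqv_refl [simp, intro]: "x \<doteq> x"
  by (simp add: eqv_def us_zero)

lemma eqv_sym: "x \<doteq> y \<Longrightarrow> y \<doteq> x"
  by (simp add: eqv_def us_minus_commute)

lemma eqv_trans [trans]: "x \<doteq> y \<Longrightarrow> y \<doteq> z \<Longrightarrow> x \<doteq> z"
  using us_diff_triangle[of x z y] us_nonneg[of "x - z"] by (simp add: eqv_def)

lemma eqv_add:
  assumes "x \<doteq> x'" "y \<doteq> y'"
  shows "x + y \<doteq> x' + y'"
proof -
  have "us ((x + y) - (x' + y')) = us ((x - x') + (y - y'))" by (simp add: algebra_simps)
  then show ?thesis
    using us_add[of "x - x'" "y - y'"] us_nonneg[of "(x + y) - (x' + y')"] assms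
    by (simp add: eqv_def)
qed

lemma eqv_mult_left: assumes "y \<doteq> y'" shows "x * y \<doteq> x * y'"
  using us_mult[of x "y - y'"] us_nonneg[of "x * y - x * y'"] assms
  by (simp add: eqv_def algebra_simps)

lemma eqv_mult_right: assumes "x \<doteq> x'" shows "x * y \<doteq> x' * y"
  using us_mult[of "x - x'" y] us_nonneg[of "x * y - x' * y"] assms
  by (simp add: eqv_def algebra_simps)

lemma eqv_minus: "x \<doteq> x' \<Longrightarrow> y \<doteq> y' \<Longrightarrow> x - y \<doteq> x' - y'"
  using eqv_add[of x x' "fconst (-1) * y" "fconst (-1) * y'"] eqv_mult_left[of y y' "fconst (-1)"]
  by (simp add: fconst_def single_uminus)

lemma eqv_sum: "(\<And>i. i \<in> A \<Longrightarrow> f i \<doteq> g i) \<Longrightarrow> sum f A \<doteq> sum g A"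
  by (induction A rule: infinite_finite_induct) (auto intro: eqv_add)

lemma eqv_fstar: "x \<doteq> y \<Longrightarrow> fstar x \<doteq> fstar y"
  by (simp add: eqv_def us_fstar flip: fstar_diff)

lemma eqv_rel: "x - y \<in> R \<Longrightarrow> x \<doteq> y"
  by (simp add: eqv_def us_zero_iff rel_seminormsD(7))

lemma eqv_seminorm: "x \<doteq> y \<Longrightarrow> p \<in> rel_seminorms R \<Longrightarrow> p (x - y) = 0"
  by (simp add: eqv_def us_zero_iff)

section \<open>The image of the free algebra in the completion\<close>

definition emb :: "'g free_star_algebra \<Rightarrow> 'g completion" where
  "emb x = null_rel R `` {\<lambda>n. x}"

lemma convergent_cauchy:
  assumes "(\<lambda>n. us (x - X n)) \<longlonglongrightarrow> 0"
  shows "X \<in> cauchy_seqs R"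
  unfolding cauchy_seqs_def
proof (intro CollectI allI impI)
  fix e :: real assume "e > 0"
  then obtain N where N: "\<And>n. n \<ge> N \<Longrightarrow> us (x - X n) < e / 2"
    using LIMSEQ_D[OF assms, of "e / 2"] us_nonneg by auto
  have "us (X m - X n) < e" if "m \<ge> N" "n \<ge> N" for m n
    using us_diff_triangle[of "X m" "X n" x] N[OF that(1)] N[OF that(2)]
    by (simp add: us_minus_commute[of "X m" x])
  then show "\<exists>N. \<forall>m\<ge>N. \<forall>n\<ge>N. us (X m - X n) < e" by blast
qed

lemma const_cauchy: "(\<lambda>n. x) \<in> cauchy_seqs R"
  by (rule convergent_cauchy[of x]) (simp add: us_zero)

text \<open>Being equivalent to a constant sequence means converging to it, and convergence already
  forces the Cauchy property. Computations on the image of \<open>emb\<close> thus reduce to limits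
  in the seminorm.\<close>

lemma in_emb_iff: "X \<in> emb x \<longleftrightarrow> (\<lambda>n. us (x - X n)) \<longlonglongrightarrow> 0"
  using convergent_cauchy[of x X] const_cauchy by (auto simp: emb_def null_rel_def)

lemma tendsto_us_le:
  assumes "\<And>n. us (f n) \<le> h n" "h \<longlonglongrightarrow> 0"
  shows "(\<lambda>n. us (f n)) \<longlonglongrightarrow> 0"
  by (rule tendsto_sandwich[OF _ _ tendsto_const assms(2)]) (use assms(1) us_nonneg in auto)

text \<open>By the triangle inequality through \<open>x\<close>, all sequences tending to
  \<open>x\<close> have the same class, so the unions over representatives in the algebra operations
  collapse to a single class on the image of \<open>emb\<close>.\<close>

lemma class_eq_emb:
  assumes "X \<in> emb x"
  shows "null_rel R `` {X} = emb x"
proof -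
  have X: "(\<lambda>n. us (x - X n)) \<longlonglongrightarrow> 0" using assms by (simp add: in_emb_iff)
  have "Y \<in> cauchy_seqs R \<and> (\<lambda>n. us (X n - Y n)) \<longlonglongrightarrow> 0 \<longleftrightarrow> (\<lambda>n. us (x - Y n)) \<longlonglongrightarrow> 0" for Y
  proof safe
    assume "(\<lambda>n. us (X n - Y n)) \<longlonglongrightarrow> 0"
    from tendsto_add[OF X this] show "(\<lambda>n. us (x - Y n)) \<longlonglongrightarrow> 0"
      by (intro tendsto_us_le[where h = "\<lambda>n. us (x - X n) + us (X n - Y n)"])
        (simp_all add: us_diff_triangle)
  next
    assume Y: "(\<lambda>n. us (x - Y n)) \<longlonglongrightarrow> 0"
    from Y show "Y \<in> cauchy_seqs R" by (rule convergent_cauchy)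
    have "us (X n - Y n) \<le> us (x - X n) + us (x - Y n)" for n
      using us_diff_triangle[of "X n" "Y n" x] by (simp add: us_minus_commute)
    with tendsto_add[OF X Y] show "(\<lambda>n. us (X n - Y n)) \<longlonglongrightarrow> 0"
      by (intro tendsto_us_le[where h = "\<lambda>n. us (x - X n) + us (x - Y n)"]) simp_all
  qed
  then show ?thesis
    using convergent_cauchy[OF X] by - (rule Set.set_eqI, simp add: null_rel_def in_emb_iff)
qed

lemma const_in_emb: "(\<lambda>n. x) \<in> emb x"
  by (simp add: in_emb_iff us_zero)

lemma emb_eq_iff: "emb x = emb y \<longleftrightarrow> x \<doteq> y"
proof
  assume "emb x = emb y"
  then have "(\<lambda>n. y) \<in> emb x" using const_in_emb by simp
  then show "x \<doteq> y" by (simp add: in_emb_iff eqv_def LIMSEQ_const_iff)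
next
  assume "x \<doteq> y"
  then have "(\<lambda>n. y) \<in> emb x" by (simp add: in_emb_iff eqv_def)
  from class_eq_emb[OF this] show "emb x = emb y" by (simp add: emb_def)
qed

lemma us_bound: "X \<in> emb x \<Longrightarrow> us (X n) \<le> us x + us (x - X n)"
  using us_add[of x "X n - x"] us_minus_commute[of "X n" x] by simp

abbreviation univ_alg :: "'g completion star_algebra" where
  "univ_alg \<equiv> universal_cstar_algebra R"

lemma emb_add: "emb x \<oplus>\<^bsub>univ_alg\<^esub> emb y = emb (x + y)"
proof -
  have "(\<lambda>n. X n + Y n) \<in> emb (x + y)" if X: "X \<in> emb x" and Y: "Y \<in> emb y" for X Y
    unfolding in_emb_iff
  proof (rule tendsto_us_le)
    show "us (x + y - (X n + Y n)) \<le> us (x - X n) + us (y - Y n)" for n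
      using us_add[of "x - X n" "y - Y n"] by (simp add: algebra_simps)
    show "(\<lambda>n. us (x - X n) + us (y - Y n)) \<longlonglongrightarrow> 0"
      using tendsto_add[of _ 0 _ _ 0] X Y by (simp add: in_emb_iff)
  qed
  from class_eq_emb[OF this] show ?thesis
    using const_in_emb[of x] const_in_emb[of y] by (auto simp: universal_cstar_algebra_def)
qed

lemma emb_mult: "emb x \<otimes>\<^bsub>univ_alg\<^esub> emb y = emb (x * y)"
proof -
  have "(\<lambda>n. X n * Y n) \<in> emb (x * y)" if X: "X \<in> emb x" and Y: "Y \<in> emb y" for X Y
    unfolding in_emb_iff
  proof (rule tendsto_us_le)
    show "us (x * y - X n * Y n)
        \<le> us (x - X n) * us y + (us x + us (x - X n)) * us (y - Y n)" for n
    proof -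
      \<comment> \<open>The factor \<open>X n\<close> beside the second difference is bounded by
        \<open>us x + us (x - X n)\<close>, so both terms tend to zero.\<close>
      have "us (x * y - X n * Y n) = us ((x - X n) * y + X n * (y - Y n))"
        by (simp add: algebra_simps)
      also have "\<dots> \<le> us ((x - X n) * y) + us (X n * (y - Y n))" by (rule us_add)
      also have "\<dots> \<le> us (x - X n) * us y + us (X n) * us (y - Y n)"
        by (intro add_mono us_mult)
      also have "\<dots> \<le> us (x - X n) * us y + (us x + us (x - X n)) * us (y - Y n)"
        by (intro add_left_mono mult_right_mono us_bound X us_nonneg)
      finally show ?thesis .
    qed
    have "(\<lambda>n. us (x - X n) * us y + (us x + us (x - X n)) * us (y - Y n))
        \<longlonglongrightarrow> 0 * us y + (us x + 0) * 0"
      using X Y unfolding in_emb_iff by (intro tendsto_intros)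
    then show "(\<lambda>n. us (x - X n) * us y + (us x + us (x - X n)) * us (y - Y n)) \<longlonglongrightarrow> 0" by simp
  qed
  from class_eq_emb[OF this] show ?thesis
    using const_in_emb[of x] const_in_emb[of y] by (auto simp: universal_cstar_algebra_def)
qed

lemma emb_scale: "scale univ_alg c (emb x) = emb (fconst c * x)"
proof -
  have "(\<lambda>n. fconst c * X n) \<in> emb (fconst c * x)" if X: "X \<in> emb x" for X
    unfolding in_emb_iff
  proof (rule tendsto_us_le)
    show "us (fconst c * x - fconst c * X n) \<le> cmod c * us (x - X n)" for n
      using us_scale[of c "x - X n"] by (simp add: algebra_simps)
    show "(\<lambda>n. cmod c * us (x - X n)) \<longlonglongrightarrow> 0"
      using X unfolding in_emb_iff by (intro tendsto_mult_right_zero)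
  qed
  from class_eq_emb[OF this] show ?thesis
    using const_in_emb[of x] by (auto simp: universal_cstar_algebra_def)
qed

lemma emb_star: "star univ_alg (emb x) = emb (fstar x)"
proof -
  have "(\<lambda>n. fstar (X n)) \<in> emb (fstar x)" if X: "X \<in> emb x" for X
    using X by (simp add: in_emb_iff us_fstar flip: fstar_diff)
  from class_eq_emb[OF this] show ?thesis
    using const_in_emb[of x] by (auto simp: universal_cstar_algebra_def)
qed

lemma emb_one: "\<one>\<^bsub>univ_alg\<^esub> = emb 1"
  by (simp add: universal_cstar_algebra_def emb_def)

lemma emb_in_carrier: "emb x \<in> carrier univ_alg"
  using const_cauchy by (auto simp: universal_cstar_algebra_def emb_def quotient_def)

lemma star_subalgebra_range_emb: "star_subalgebra univ_alg (range emb)"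
  unfolding star_subalgebra_def
  by (auto simp: emb_in_carrier emb_one emb_add emb_mult emb_scale emb_star)

text \<open>With \<open>star_subalgebra_range_emb\<close> this identifies the generated subalgebra
  as the image of \<open>emb\<close>: words in the generators and their adjoints span the free
  algebra, so no limits enter.\<close>

lemma range_emb_subset:
  assumes S: "star_subalgebra univ_alg S" and gens: "\<And>g. emb (fgen g) \<in> S"
  shows "range emb \<subseteq> S"
proof -
  note S' = S[unfolded star_subalgebra_def]
  have mult: "emb (x * y) \<in> S" and add: "emb (x + y) \<in> S" if "emb x \<in> S" "emb y \<in> S" for x y
    using S' that by (simp_all flip: emb_mult emb_add)
  have star: "emb (fstar x) \<in> S" if "emb x \<in> S" for x
    using S' that by (simp flip: emb_star)
  have scale: "emb (fconst c * x) \<in> S" if "emb x \<in> S" for c x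
    using S' that by (metis emb_scale)
  have "emb x \<in> S" for x
  proof (induction x rule: free_star_algebra_induct)
    case one
    show ?case using S' by (simp flip: emb_one)
  qed (simp_all add: mult add star scale gens)
  then show ?thesis by blast
qed

end


section \<open>Degrees of words\<close>

text \<open>The target group is kept abstract because the degree serves both as the grading of words
  and as the displacement of basis vectors.\<close>

definition letter_degree :: "('g \<Rightarrow> 'i::ab_group_add) \<Rightarrow> 'g \<times> bool \<Rightarrow> 'i" where
  "letter_degree deg u = (if snd u then - deg (fst u) else deg (fst u))"

definition word_degree :: "('g \<Rightarrow> 'i::ab_group_add) \<Rightarrow> ('g \<times> bool) list \<Rightarrow> 'i" where
  "word_degree deg ws = sum_list (map (letter_degree deg) ws)"

lemma word_degree_Nil: "word_degree deg [] = 0"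
  and word_degree_Cons: "word_degree deg (u # ws) = letter_degree deg u + word_degree deg ws"
  and word_degree_append: "word_degree deg (ws @ vs) = word_degree deg ws + word_degree deg vs"
  by (simp_all add: word_degree_def)


section \<open>Quasi-commuting elements\<close>

definition monomial :: "('g \<times> bool) list \<Rightarrow> 'g free_star_algebra" where
  "monomial ws = Poly_Mapping.single (Word ws) 1"

abbreviation letter :: "'g \<times> bool \<Rightarrow> 'g free_star_algebra" where
  "letter u \<equiv> monomial [u]"

lemma monomial_Nil: "monomial [] = 1"
  by (simp add: monomial_def flip: zero_star_word_def)

lemma monomial_append: "monomial (ws @ vs) = monomial ws * monomial vs"
  by (simp add: monomial_def mult_single plus_star_word_def)

lemma monomial_Cons: "monomial (u # ws) = letter u * monomial ws"
  using monomial_append[of "[u]" ws] by simp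

lemma letter_False: "letter (g, False) = fgen g"
  by (simp add: monomial_def fgen_def)

lemma letter_True: "letter (g, True) = fstar (fgen g)"
  by (simp add: monomial_def fgen_def fstar_single adj_word_def)

lemma fstar_letter: "fstar (letter (g, s)) = letter (g, \<not> s)"
  by (simp add: monomial_def fstar_single adj_word_def)

lemma fconst_inverse: "c \<noteq> 0 \<Longrightarrow> fconst c * (fconst (1 / c) * x) = x"
    "c \<noteq> 0 \<Longrightarrow> fconst (1 / c) * (fconst c * x) = x"
  by (simp_all add: fconst_mult fconst_one flip: mult.assoc)

context star_relations
begin

definition comm_by :: "complex \<Rightarrow> 'g free_star_algebra \<Rightarrow> 'g free_star_algebra \<Rightarrow> bool" where
  "comm_by c g h \<longleftrightarrow> g * h \<doteq> fconst c * (h * g)"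

lemma comm_by_sym:
  assumes "comm_by c g h" "c \<noteq> 0"
  shows "comm_by (1 / c) h g"
  using eqv_mult_left[OF assms(1)[unfolded comm_by_def], of "fconst (1 / c)"] assms(2)
  by (simp add: comm_by_def fconst_inverse eqv_sym)

lemma comm_by_mult:
  assumes "comm_by c g u" "comm_by d g v"
  shows "comm_by (c * d) g (u * v)"
proof -
  have "g * (u * v) = (g * u) * v" by (simp add: mult.assoc)
  also have "\<dots> \<doteq> (fconst c * (u * g)) * v"
    by (intro eqv_mult_right assms(1)[unfolded comm_by_def])
  also have "\<dots> = (fconst c * u) * (g * v)" by (simp add: mult.assoc)
  also have "\<dots> \<doteq> (fconst c * u) * (fconst d * (v * g))"
    by (intro eqv_mult_left assms(2)[unfolded comm_by_def])
  also have "\<dots> = fconst (c * d) * (u * v * g)"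
    by (simp add: fconst_left_commute[of u] mult.assoc flip: fconst_mult)
  finally show ?thesis unfolding comm_by_def .
qed

lemma comm_by_fstar:
  assumes "comm_by c g h"
  shows "comm_by (cnj c) (fstar h) (fstar g)"
  using eqv_fstar[OF assms[unfolded comm_by_def]]
  by (simp add: comm_by_def fstar_mult fstar_fconst fconst_commute)

text \<open>Insert \<open>u * u'\<close> on the right of \<open>u' * h\<close>, exchange
  \<open>h\<close> and \<open>u\<close> in the middle and cancel \<open>u' * u\<close>.\<close>

lemma comm_by_unitary:
  assumes "comm_by c u h" "c \<noteq> 0" and unitary: "u * u' \<doteq> 1" "u' * u \<doteq> 1"
  shows "comm_by (1 / c) u' h"
proof -
  have "u' * h = (u' * h) * 1" by simp
  also have "\<dots> \<doteq> (u' * h) * (u * u')" by (intro eqv_mult_left eqv_sym[OF unitary(1)])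
  also have "\<dots> = u' * (h * u) * u'" by (simp add: mult.assoc)
  also have "\<dots> \<doteq> u' * (fconst (1 / c) * (u * h)) * u'"
    by (intro eqv_mult_left eqv_mult_right comm_by_sym[OF assms(1,2), unfolded comm_by_def])
  also have "\<dots> = fconst (1 / c) * ((u' * u) * (h * u'))"
    by (simp add: fconst_left_commute[of u'] mult.assoc)
  also have "\<dots> \<doteq> fconst (1 / c) * (1 * (h * u'))"
    by (intro eqv_mult_left eqv_mult_right unitary(2))
  finally show ?thesis by (simp add: comm_by_def)
qed

text \<open>The scalar is forgotten because normal ordering only needs that exchanges are possible;
  nonvanishing keeps the relation symmetric.\<close>

definition qcomm :: "'g free_star_algebra \<Rightarrow> 'g free_star_algebra \<Rightarrow> bool" where
  "qcomm g h \<longleftrightarrow> (\<exists>c. c \<noteq> 0 \<and> comm_by c g h)"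

lemma qcommI: "comm_by c g h \<Longrightarrow> c \<noteq> 0 \<Longrightarrow> qcomm g h"
  by (auto simp: qcomm_def)

lemma qcomm_sym: "qcomm g h \<Longrightarrow> qcomm h g"
  unfolding qcomm_def by (metis comm_by_sym divide_eq_0_iff one_neq_zero)

lemma qcomm_mult: "qcomm g u \<Longrightarrow> qcomm g v \<Longrightarrow> qcomm g (u * v)"
  unfolding qcomm_def by (metis comm_by_mult mult_eq_0_iff)

lemma qcomm_fstar: "qcomm g h \<Longrightarrow> qcomm (fstar g) (fstar h)"
  by (meson comm_by_fstar complex_cnj_zero_iff qcomm_def qcomm_sym)

lemma qcomm_unitary: "qcomm u h \<Longrightarrow> u * u' \<doteq> 1 \<Longrightarrow> u' * u \<doteq> 1 \<Longrightarrow> qcomm u' h"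
  unfolding qcomm_def by (metis comm_by_unitary divide_eq_0_iff one_neq_zero)

lemma qcomm_refl: "qcomm g g"
  by (rule qcommI[of 1]) (simp_all add: comm_by_def fconst_one)

lemma qcomm_one: "qcomm g 1"
  by (rule qcommI[of 1]) (simp_all add: comm_by_def fconst_one)

lemma qcomm_swap:
  assumes "qcomm g x"
  obtains c where "g * (x * z) \<doteq> fconst c * (x * (g * z))"
proof -
  obtain c where "g * x \<doteq> fconst c * (x * g)" using assms by (auto simp: qcomm_def comm_by_def)
  from eqv_mult_right[OF this, of z] show thesis by (intro that) (simp add: mult.assoc)
qed

end


section \<open>Normal form in the *-algebra of \<open>U\<^sub>q(2)\<close>\<close>

locale uq2 =
  fixes q :: complex
  assumes q_nonzero: "q \<noteq> 0" and q_norm: "cmod q \<noteq> 1"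
begin

sublocale star_relations "uq2_relations q"
  by standard (rule uq2_seminorms_bdd[OF q_nonzero q_norm])

notation eqv (infix "\<doteq>" 50)

abbreviation a where "a \<equiv> fgen Gen_a"
abbreviation b where "b \<equiv> fgen Gen_b"
abbreviation D where "D \<equiv> fgen Gen_D"

definition Q :: real where "Q = (cmod q)\<^sup>2"

definition lam :: complex where "lam = q\<^sup>2 / of_real ((cmod q)\<^sup>2)"

definition y :: "uq2_gen free_star_algebra" where "y = b * fstar b"

lemma lam_nonzero: "lam \<noteq> 0"
  using q_nonzero by (simp add: lam_def)

lemma relations:
  "b * a \<doteq> fconst q * (a * b)" "fstar a * b \<doteq> fconst q * (b * fstar a)"
  "b * fstar b \<doteq> fstar b * b" "a * fstar a + b * fstar b \<doteq> 1" "a * D \<doteq> D * a"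
  "b * D \<doteq> fconst lam * (D * b)" "D * fstar D \<doteq> 1" "fstar D * D \<doteq> 1"
  "fstar a * a + fconst (of_real Q) * (fstar b * b) \<doteq> 1"
  by (rule eqv_rel, simp add: uq2_relations_def Let_def lam_def Q_def)+

lemma a_fstar_a: "a * fstar a \<doteq> 1 - y"
  using eqv_minus[OF relations(4) eqv_refl[of y]] by (simp add: y_def)

lemma fstar_a_a: "fstar a * a \<doteq> 1 - fconst (of_real Q) * y"
proof -
  have "fconst (of_real Q) * (fstar b * b) \<doteq> fconst (of_real Q) * y"
    unfolding y_def by (intro eqv_mult_left eqv_sym[OF relations(3)])
  from eqv_minus[OF relations(9) this] show ?thesis by simp
qed

lemma qcomm_D: "qcomm h D \<Longrightarrow> qcomm h (fstar D)"
  by (meson qcomm_sym qcomm_unitary relations(7,8))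

text \<open>Eight exchanges come from the relations, those with \<open>fstar D\<close> by unitarity;
  adjoints and symmetry give the others. The hypothesis keeps \<open>a\<close> from meeting
  \<open>fstar a\<close>, whose two products are different polynomials in \<open>y\<close>.\<close>

lemma qcomm_letters:
  assumes "fst u \<noteq> Gen_a \<or> fst v \<noteq> Gen_a"
  shows "qcomm (letter u) (letter v)"
proof -
  have ab: "qcomm a b"
    by (rule qcomm_sym[OF qcommI[of q]])
      (use relations(1) q_nonzero in \<open>simp_all add: comm_by_def\<close>)
  have a'b: "qcomm (fstar a) b"
    by (rule qcommI[of q]) (use relations(2) q_nonzero in \<open>simp_all add: comm_by_def\<close>)
  have bb': "qcomm b (fstar b)"
    by (rule qcommI[of 1]) (use relations(3) in \<open>simp_all add: comm_by_def fconst_one\<close>)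
  have aD: "qcomm a D"
    by (rule qcommI[of 1]) (use relations(5) in \<open>simp_all add: comm_by_def fconst_one\<close>)
  have bD: "qcomm b D"
    by (rule qcommI[of lam]) (use relations(6) lam_nonzero in \<open>simp_all add: comm_by_def\<close>)
  have DD': "qcomm D (fstar D)"
    by (rule qcomm_D[OF qcomm_refl])
  note base = ab a'b bb' aD qcomm_D[OF aD] bD qcomm_D[OF bD] DD'
  note base' = base base[THEN qcomm_fstar, unfolded fstar_fstar]
  obtain g s h t where uv: "u = (g, s)" "v = (h, t)" by (cases u, cases v)
  show ?thesis
    using assms unfolding uv
    by (cases g; cases h; cases s; cases t)
      (simp_all add: letter_False letter_True qcomm_refl base' base'[THEN qcomm_sym])
qed

lemma qcomm_monomial: "(\<And>u. u \<in> set ws \<Longrightarrow> qcomm g (letter u)) \<Longrightarrow> qcomm g (monomial ws)"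
proof (induction ws)
  case Nil
  then show ?case by (simp add: monomial_Nil qcomm_one)
next
  case (Cons u ws)
  then show ?case unfolding monomial_Cons[of u ws] by (intro qcomm_mult) auto
qed

lemma y_letters: "y = letter (Gen_b, False) * letter (Gen_b, True)"
  by (simp add: y_def letter_False letter_True)

text \<open>Both factors of \<open>y\<close> are letters other than \<open>a\<close> and its
  adjoint, so every letter can be moved past them.\<close>

lemma qcomm_monomial_y: "qcomm (monomial ws) y"
proof (rule qcomm_sym, rule qcomm_monomial, rule qcomm_sym)
  fix u show "qcomm (letter u) y"
    unfolding y_letters by (intro qcomm_mult qcomm_letters) simp_all
qed

section \<open>Polynomials in \<open>y\<close>\<close>

definition ev :: "complex poly \<Rightarrow> uq2_gen free_star_algebra" where
  "ev P = (\<Sum>i\<le>degree P. fconst (coeff P i) * y ^ i)"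

lemma ev_eq_sum:
  assumes "degree P \<le> n"
  shows "ev P = (\<Sum>i\<le>n. fconst (coeff P i) * y ^ i)"
  unfolding ev_def by (rule sum.mono_neutral_left) (use assms in \<open>auto simp: coeff_eq_0 fconst_0\<close>)

lemma ev_0 [simp]: "ev 0 = 0"
  by (simp add: ev_def fconst_0)

lemma ev_pCons: "ev (pCons c P) = fconst c + y * ev P"
proof -
  have "ev (pCons c P) = (\<Sum>i\<le>Suc (degree P). fconst (coeff (pCons c P) i) * y ^ i)"
    by (rule ev_eq_sum[OF degree_pCons_le])
  also have "\<dots> = fconst c + y * ev P"
    unfolding sum.atMost_Suc_shift ev_def by (simp add: sum_distrib_left fconst_left_commute[of y])
  finally show ?thesis .
qed

lemma ev_add: "ev (P + R) = ev P + ev R"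
  by (induction P R rule: poly_induct2) (simp_all add: ev_pCons fconst_add algebra_simps)

lemma ev_smult: "ev (smult c P) = fconst c * ev P"
  by (induction P) (simp_all add: ev_pCons fconst_left_commute[of y] distrib_left flip: fconst_mult)

text \<open>This is exact in the free algebra, not just modulo the relations: only powers of the
  single element \<open>y\<close> and central constants are multiplied.\<close>

lemma ev_mult: "ev (P * R) = ev P * ev R"
  by (induction P) (simp_all add: ev_pCons ev_add ev_smult fconst_0 algebra_simps)

lemma ev_sum: "ev (sum f A) = (\<Sum>i\<in>A. ev (f i))"
  by (induction A rule: infinite_finite_induct) (simp_all add: ev_add)

text \<open>Moving \<open>g\<close> past a power of \<open>y\<close> costs only a scalar, so
  \<open>R\<close> is \<open>P\<close> with rescaled coefficients; later only its existence
  matters.\<close>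

lemma qcomm_ev:
  assumes "qcomm g y"
  shows "\<exists>R. g * ev P \<doteq> ev R * g"
proof (induction P)
  case 0
  show ?case by (intro exI[of _ 0]) simp
next
  case (pCons c P)
  then obtain R where R: "g * ev P \<doteq> ev R * g" by blast
  obtain k where k: "g * (y * ev P) \<doteq> fconst k * (y * (g * ev P))"
    using qcomm_swap[OF assms] .
  have "g * ev (pCons c P) = fconst c * g + g * (y * ev P)"
    by (simp add: ev_pCons distrib_left fconst_commute[of g])
  also have "\<dots> \<doteq> fconst c * g + fconst k * (y * (g * ev P))"
    by (intro eqv_add eqv_refl k)
  also have "\<dots> \<doteq> fconst c * g + fconst k * (y * (ev R * g))"
    by (intro eqv_add eqv_refl eqv_mult_left R)
  also have "\<dots> = ev (pCons c (smult k R)) * g"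
    by (simp add: ev_pCons ev_smult fconst_left_commute[of y] algebra_simps)
  finally show ?case ..
qed

section \<open>Normal words and the reduction of words to them\<close>

primrec gen_degree :: "uq2_gen \<Rightarrow> int \<times> int \<times> int" where
  "gen_degree Gen_a = (1, 0, 0)"
| "gen_degree Gen_b = (0, 1, 0)"
| "gen_degree Gen_D = (0, 0, 1)"

definition spower :: "'g \<Rightarrow> int \<Rightarrow> ('g \<times> bool) list" where
  "spower g k = replicate (nat \<bar>k\<bar>) (g, k < 0)"

definition normal_word :: "int \<times> int \<times> int \<Rightarrow> (uq2_gen \<times> bool) list" where
  "normal_word d = spower Gen_b (fst (snd d)) @ spower Gen_a (fst d) @ spower Gen_D (snd (snd d))"

text \<open>The products are \<open>1 - y\<close> and \<open>1 - Q y\<close> for \<open>a\<close>,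
  always \<open>y\<close> for \<open>b\<close>, and \<open>1\<close> for \<open>D\<close>.\<close>

lemma letter_product: "\<exists>E. letter (g, s) * letter (g, \<not> s) \<doteq> ev E"
proof -
  have ev1: "ev 1 = 1" and evy: "ev [:0, 1:] = y" and ev1y: "ev [:1, -1:] = 1 - y"
    and ev1Qy: "ev [:1, - of_real Q:] = 1 - fconst (of_real Q) * y"
    by (simp_all add: one_pCons ev_pCons fconst_one fconst_0 fconst_commute[of y])
      (simp_all add: fconst_def single_uminus)
  show ?thesis
  proof (cases g)
    case Gen_a
    then show ?thesis
      using a_fstar_a fstar_a_a ev1y ev1Qy
      by (cases s) (auto simp: letter_False letter_True intro: exI[of _ "[:1, -1:]"]
          exI[of _ "[:1, - of_real Q:]"])
  next
    case Gen_b
    then show ?thesis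
      using eqv_sym[OF relations(3)] evy
      by (intro exI[of _ "[:0, 1:]"], cases s) (auto simp: letter_False letter_True y_def)
  next
    case Gen_D
    then show ?thesis
      using relations(7,8) ev1 by (intro exI[of _ 1], cases s) (auto simp: letter_False letter_True)
  qed
qed

text \<open>Either the letter lengthens the power and \<open>E = 1\<close>, or it meets its own
  adjoint at the front and \<open>letter_product\<close> turns the pair into a polynomial.\<close>

lemma letter_spower:
  "\<exists>E. letter (g, s) * monomial (spower g k)
        \<doteq> ev E * monomial (spower g (k + (if s then - 1 else 1)))"
proof (cases "k = 0 \<or> s = (k < 0)")
  case True
  have "spower g (k + (if s then - 1 else 1)) = (g, s) # spower g k"
  proof (cases s)
    case True
    with \<open>k = 0 \<or> s = (k < 0)\<close> have "k \<le> 0" by auto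
    then have "nat \<bar>k - 1\<bar> = Suc (nat \<bar>k\<bar>)" by simp
    with True \<open>k \<le> 0\<close> show ?thesis by (cases "k = 0") (simp_all add: spower_def)
  next
    case False
    with \<open>k = 0 \<or> s = (k < 0)\<close> have "k \<ge> 0" by auto
    then have "nat \<bar>k + 1\<bar> = Suc (nat \<bar>k\<bar>)" by simp
    with False \<open>k \<ge> 0\<close> show ?thesis by (simp add: spower_def)
  qed
  then have "letter (g, s) * monomial (spower g k)
      = ev 1 * monomial (spower g (k + (if s then - 1 else 1)))"
    by (simp add: monomial_Cons[of _ "spower g k"] one_pCons ev_pCons fconst_one)
  then show ?thesis by (metis eqv_refl)
next
  case False
  have "spower g k = (g, \<not> s) # spower g (k + (if s then - 1 else 1))"
  proof (cases s)
    case True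
    with False have "k > 0" by auto
    then have "nat \<bar>k\<bar> = Suc (nat \<bar>k - 1\<bar>)" by simp
    with True \<open>k > 0\<close> show ?thesis by (simp add: spower_def)
  next
    case False
    with \<open>\<not> (k = 0 \<or> s = (k < 0))\<close> have "k < 0" by auto
    then have "nat \<bar>k\<bar> = Suc (nat \<bar>k + 1\<bar>)" by simp
    \<comment> \<open>At \<open>k = - 1\<close> the shortened power is empty, so the adjoint flag
      attached to exponent \<open>0\<close> does no harm.\<close>
    with False \<open>k < 0\<close> show ?thesis by (cases "k = - 1") (simp_all add: spower_def)
  qed
  then have eq: "letter (g, s) * monomial (spower g k)
      = letter (g, s) * letter (g, \<not> s) * monomial (spower g (k + (if s then - 1 else 1)))"
    using monomial_Cons[of "(g, \<not> s)" "spower g (k + (if s then - 1 else 1))"]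
    by (simp only: mult.assoc)
  obtain E where "letter (g, s) * letter (g, \<not> s) \<doteq> ev E" using letter_product by blast
  then show ?thesis unfolding eq by (blast intro: eqv_mult_right)
qed

text \<open>A letter passes the prefix \<open>p\<close> up to a scalar, is absorbed by the power of its own generator,
  and the resulting polynomial in \<open>y\<close> passes \<open>p\<close> back to the left.\<close>

lemma letter_through:
  assumes "qcomm (letter (g, s)) (monomial p)"
  shows "\<exists>E. letter (g, s) * monomial (p @ spower g k @ r)
        \<doteq> ev E * monomial (p @ spower g (k + (if s then - 1 else 1)) @ r)"
proof -
  let ?k = "k + (if s then - 1 else 1)"
  obtain c where c: "letter (g, s) * (monomial p * monomial (spower g k @ r))
      \<doteq> fconst c * (monomial p * (letter (g, s) * monomial (spower g k @ r)))"
    using qcomm_swap[OF assms] .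
  obtain E where E: "letter (g, s) * monomial (spower g k) \<doteq> ev E * monomial (spower g ?k)"
    using letter_spower by blast
  obtain E' where E': "monomial p * ev E \<doteq> ev E' * monomial p"
    using qcomm_ev[OF qcomm_monomial_y] by blast
  have "letter (g, s) * monomial (p @ spower g k @ r)
      \<doteq> fconst c * (monomial p * ((letter (g, s) * monomial (spower g k)) * monomial r))"
    using c by (simp add: monomial_append mult.assoc)
  also have "\<dots> \<doteq> fconst c * (monomial p * ((ev E * monomial (spower g ?k)) * monomial r))"
    by (intro eqv_mult_left eqv_mult_right E)
  also have "\<dots> = fconst c * ((monomial p * ev E) * monomial (spower g ?k @ r))"
    by (simp add: monomial_append mult.assoc)
  also have "\<dots> \<doteq> fconst c * ((ev E' * monomial p) * monomial (spower g ?k @ r))"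
    by (intro eqv_mult_left eqv_mult_right E')
  also have "\<dots> = ev (smult c E') * monomial (p @ spower g ?k @ r)"
    by (simp add: monomial_append ev_smult mult.assoc)
  finally show ?thesis ..
qed

text \<open>The prefix to cross is empty for \<open>b\<close>, the power of \<open>b\<close> for
  \<open>a\<close>, and the powers of \<open>b\<close> and \<open>a\<close> for \<open>D\<close>; in
  this order \<open>a\<close> never has to pass its adjoint.\<close>

lemma letter_normal_word:
  "\<exists>E. letter u * monomial (normal_word d)
        \<doteq> ev E * monomial (normal_word (letter_degree gen_degree u + d))"
proof -
  obtain g s where u: "u = (g, s)" by (cases u)
  obtain k j l where d: "d = (k, j, l)" by (cases d)
  have step: "qcomm (letter (g, s)) (monomial p)"
    if "\<And>v. v \<in> set p \<Longrightarrow> fst v \<noteq> Gen_a \<or> g \<noteq> Gen_a" for p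
    by (rule qcomm_monomial, rule qcomm_letters) (use that in auto)
  show ?thesis
  proof (cases g)
    case Gen_a
    have "qcomm (letter (g, s)) (monomial (spower Gen_b j))"
      by (rule step) (simp add: spower_def)
    from letter_through[OF this, of k "spower Gen_D l"] show ?thesis
      by (cases s) (simp_all add: u d Gen_a normal_word_def letter_degree_def algebra_simps)
  next
    case Gen_b
    have "qcomm (letter (g, s)) (monomial [])"
      by (rule step) simp
    from letter_through[OF this, of j "spower Gen_a k @ spower Gen_D l"] show ?thesis
      by (cases s) (simp_all add: u d Gen_b normal_word_def letter_degree_def algebra_simps)
  next
    case Gen_D
    have "qcomm (letter (g, s)) (monomial (spower Gen_b j @ spower Gen_a k))"
      by (rule step) (simp add: Gen_D)
    from letter_through[OF this, of l "[]"] show ?thesis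
      by (cases s) (simp_all add: u d Gen_D normal_word_def letter_degree_def algebra_simps)
  qed
qed

text \<open>Induction from the right end: a new letter passes the polynomial by
  \<open>qcomm_ev\<close> and is then absorbed by the normal word.\<close>

lemma monomial_normal_form:
  "\<exists>P. monomial ws \<doteq> ev P * monomial (normal_word (word_degree gen_degree ws))"
proof (induction ws)
  case Nil
  have "monomial [] = ev 1 * monomial (normal_word (word_degree gen_degree []))"
    by (simp add: normal_word_def word_degree_Nil spower_def one_pCons ev_pCons fconst_one monomial_Nil)
  then show ?case by (metis eqv_refl)
next
  case (Cons u ws)
  let ?N = "\<lambda>vs. monomial (normal_word (word_degree gen_degree vs))"
  obtain P where P: "monomial ws \<doteq> ev P * ?N ws" using Cons by blast
  obtain R where R: "letter u * ev P \<doteq> ev R * letter u" using qcomm_ev[OF qcomm_monomial_y] by blast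
  obtain E where E: "letter u * ?N ws \<doteq> ev E * ?N (u # ws)"
    unfolding word_degree_Cons using letter_normal_word by blast
  have "monomial (u # ws) = letter u * monomial ws" by (rule monomial_Cons)
  also have "\<dots> \<doteq> letter u * (ev P * ?N ws)" by (intro eqv_mult_left P)
  also have "\<dots> = (letter u * ev P) * ?N ws" by (simp add: mult.assoc)
  also have "\<dots> \<doteq> (ev R * letter u) * ?N ws" by (intro eqv_mult_right R)
  also have "\<dots> = ev R * (letter u * ?N ws)" by (simp add: mult.assoc)
  also have "\<dots> \<doteq> ev R * (ev E * ?N (u # ws))" by (intro eqv_mult_left E)
  also have "\<dots> = ev (R * E) * ?N (u # ws)" by (simp add: ev_mult mult.assoc)
  finally show ?case ..
qed

end


section \<open>Weighted shifts on finitely supported functions\<close>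

typedef 'i fsupp = "{f :: 'i \<Rightarrow> complex. finite {i. f i \<noteq> 0}}"
  morphisms coord Abs_fsupp
  by (rule exI[of _ "\<lambda>_. 0"]) simp

setup_lifting type_definition_fsupp

abbreviation support :: "'i fsupp \<Rightarrow> 'i set" where
  "support v \<equiv> {i. coord v i \<noteq> 0}"

lemma finite_support: "finite (support v)"
  using coord[of v] by simp

lemma fsupp_eqI: "(\<And>i. coord v i = coord w i) \<Longrightarrow> v = w"
  by (simp add: coord_inject[symmetric] fun_eq_iff)

instantiation fsupp :: (type) real_vector
begin

lift_definition zero_fsupp :: "'a fsupp" is "\<lambda>_. 0" by simp

lift_definition plus_fsupp :: "'a fsupp \<Rightarrow> 'a fsupp \<Rightarrow> 'a fsupp" is "\<lambda>f g i. f i + g i"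
  subgoal for f g by (rule finite_subset[of _ "{i. f i \<noteq> 0} \<union> {i. g i \<noteq> 0}"]) auto
  done

lift_definition minus_fsupp :: "'a fsupp \<Rightarrow> 'a fsupp \<Rightarrow> 'a fsupp" is "\<lambda>f g i. f i - g i"
  subgoal for f g by (rule finite_subset[of _ "{i. f i \<noteq> 0} \<union> {i. g i \<noteq> 0}"]) auto
  done

lift_definition uminus_fsupp :: "'a fsupp \<Rightarrow> 'a fsupp" is "\<lambda>f i. - f i" by simp

lift_definition scaleR_fsupp :: "real \<Rightarrow> 'a fsupp \<Rightarrow> 'a fsupp" is "\<lambda>r f i. r *\<^sub>R f i"
  by simp

instance
  by standard (transfer, simp add: fun_eq_iff scaleR_add_right scaleR_add_left)+

end

lemma coord_simps [simp]:
  "coord 0 i = 0" "coord (v + w) i = coord v i + coord w i" "coord (v - w) i = coord v i - coord w i"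
  "coord (- v) i = - coord v i" "coord (r *\<^sub>R v) i = r *\<^sub>R coord v i"
  by (transfer, simp)+

instantiation fsupp :: (type) real_inner
begin

text \<open>The real part of the Hermitian inner product: it gives the same norm and the same
  adjoints, and brings in the general theory of \<open>real_inner\<close>.\<close>

definition inner_fsupp :: "'a fsupp \<Rightarrow> 'a fsupp \<Rightarrow> real" where
  "v \<bullet> w = (\<Sum>i\<in>support v. coord v i \<bullet> coord w i)"

definition norm_fsupp :: "'a fsupp \<Rightarrow> real" where "norm_fsupp v = sqrt (v \<bullet> v)"

definition sgn_fsupp :: "'a fsupp \<Rightarrow> 'a fsupp" where "sgn_fsupp v = v /\<^sub>R norm v"

definition dist_fsupp :: "'a fsupp \<Rightarrow> 'a fsupp \<Rightarrow> real" where "dist_fsupp v w = norm (v - w)"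

definition uniformity_fsupp :: "('a fsupp \<times> 'a fsupp) filter" where
  "uniformity_fsupp = (INF e\<in>{0<..}. principal {(v, w). dist v w < e})"

definition open_fsupp :: "'a fsupp set \<Rightarrow> bool" where
  "open_fsupp U \<longleftrightarrow> (\<forall>v\<in>U. \<forall>\<^sub>F (v', w) in uniformity. v' = v \<longrightarrow> w \<in> U)"

lemma inner_fsupp_superset:
  assumes "finite A" "support v \<subseteq> A"
  shows "v \<bullet> w = (\<Sum>i\<in>A. coord v i \<bullet> coord w i)"
  unfolding inner_fsupp_def by (rule sum.mono_neutral_left) (use assms in auto)

instance
proof
  fix u v w :: "'a fsupp" and r :: real
  show "v \<bullet> w = w \<bullet> v"
    using inner_fsupp_superset[of "support v \<union> support w" v w]
      inner_fsupp_superset[of "support v \<union> support w" w v]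
    by (simp add: finite_support inner_commute)
  have "support (u + v) \<subseteq> support u \<union> support v" by auto
  then show "(u + v) \<bullet> w = u \<bullet> w + v \<bullet> w"
    using inner_fsupp_superset[of "support u \<union> support v" u w]
      inner_fsupp_superset[of "support u \<union> support v" v w]
      inner_fsupp_superset[of "support u \<union> support v" "u + v" w]
    by (simp add: finite_support inner_add_left sum.distrib)
  have "support (r *\<^sub>R v) \<subseteq> support v" by auto
  from inner_fsupp_superset[OF finite_support this, of w] show "(r *\<^sub>R v) \<bullet> w = r * (v \<bullet> w)"
    by (simp add: inner_fsupp_def sum_distrib_left)
  show "0 \<le> v \<bullet> v" by (simp add: inner_fsupp_def sum_nonneg)
  show "v \<bullet> v = 0 \<longleftrightarrow> v = 0"
    by (auto simp: inner_fsupp_def sum_nonneg_eq_0_iff finite_support intro: fsupp_eqI)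
qed (simp_all add: norm_fsupp_def sgn_fsupp_def dist_fsupp_def uniformity_fsupp_def open_fsupp_def)

end

section \<open>Weighted shifts, their adjoints and their norms\<close>

lift_definition basis_vector :: "'i \<Rightarrow> 'i fsupp" is "\<lambda>i j. if j = i then 1 else 0"
  by simp

lemma coord_basis_vector: "coord (basis_vector i) j = (if j = i then 1 else 0)"
  by transfer simp

text \<open>Weights are indexed by the source: \<open>e_i\<close> goes to \<open>c i\<close> times
  \<open>e_(i + d)\<close>, whence the argument \<open>i - d\<close> when coordinates are read at
  the target.\<close>

lift_definition wshift :: "('i::ab_group_add \<Rightarrow> complex) \<Rightarrow> 'i \<Rightarrow> 'i fsupp \<Rightarrow> 'i fsupp" is
  "\<lambda>c d f i. c (i - d) * f (i - d)"
proof -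
  fix c :: "'i \<Rightarrow> complex" and d and f :: "'i \<Rightarrow> complex"
  assume "finite {i. f i \<noteq> 0}"
  then have "finite ((\<lambda>i. i + d) ` {i. f i \<noteq> 0})" by simp
  then show "finite {i. c (i - d) * f (i - d) \<noteq> 0}"
    by (rule finite_subset[rotated]) (auto intro: image_eqI[of _ _ "_ - d"])
qed

lemma coord_wshift [simp]: "coord (wshift c d v) i = c (i - d) * coord v (i - d)"
  by transfer simp

lemma wshift_wshift: "wshift c d (wshift c' d' v) = wshift (\<lambda>i. c (i + d') * c' i) (d + d') v"
  by (rule fsupp_eqI) (simp add: algebra_simps)

lemma wshift_inner: "wshift c d v \<bullet> w = (\<Sum>i\<in>support v. (c i * coord v i) \<bullet> coord w (i + d))"
proof -
  have "support (wshift c d v) \<subseteq> (\<lambda>i. i + d) ` support v"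
    by (auto intro: image_eqI[of _ _ "_ - d"])
  from inner_fsupp_superset[OF _ this, of w] show ?thesis
    by (simp add: finite_support sum.reindex)
qed

lemma wshift_adjoint: "wshift c d v \<bullet> w = v \<bullet> wshift (\<lambda>i. cnj (c (i - d))) (- d) w"
  unfolding wshift_inner inner_fsupp_def[of v]
  by (rule sum.cong) (simp_all add: inner_complex_def algebra_simps)

text \<open>Distinct basis vectors go to multiples of distinct, hence orthogonal, basis vectors, so
  the squared norms can be compared term by term.\<close>

lemma norm_wshift_le:
  assumes "\<And>i. cmod (c i) \<le> B"
  shows "norm (wshift c d v) \<le> B * norm v"
proof (rule power2_le_imp_le)
  have "0 \<le> B" using assms norm_ge_zero by (rule order_trans[rotated])
  have "(norm (wshift c d v))\<^sup>2 = (\<Sum>i\<in>support v. (cmod (c i * coord v i))\<^sup>2)"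
    by (simp add: power2_norm_eq_inner wshift_inner)
  also have "\<dots> \<le> (\<Sum>i\<in>support v. (B * cmod (coord v i))\<^sup>2)"
    using assms by (intro sum_mono power_mono) (simp_all add: norm_mult mult_right_mono)
  also have "\<dots> = (B * norm v)\<^sup>2"
    unfolding power_mult_distrib power2_norm_eq_inner inner_fsupp_def
    by (simp add: sum_distrib_left power2_norm_eq_inner)
  finally show "(norm (wshift c d v))\<^sup>2 \<le> (B * norm v)\<^sup>2" .
  show "0 \<le> B * norm v" using \<open>0 \<le> B\<close> by simp
qed

lemma bounded_linear_wshift:
  assumes "\<And>i. cmod (c i) \<le> B"
  shows "bounded_linear (wshift c d)"
proof (rule bounded_linear_intro)
  show "wshift c d (v + w) = wshift c d v + wshift c d w" for v w
    by (rule fsupp_eqI) (simp add: algebra_simps)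
  show "wshift c d (r *\<^sub>R v) = r *\<^sub>R wshift c d v" for r v
    by (rule fsupp_eqI) (simp add: scaleR_conv_of_real)
  show "norm (wshift c d v) \<le> norm v * B" for v
    using norm_wshift_le[OF assms] by (simp add: mult.commute)
qed


section \<open>Representations by weighted shifts\<close>

text \<open>Every generator \<open>g\<close> acts as \<open>e\<^sub>i \<mapsto> gw g i e\<^sub>j\<close> with \<open>j = i + gd g\<close>, on the space spanned by the
  basis vectors with index in \<open>S\<close>; the unit acts as the projection to that space.\<close>

locale weighted_shifts =
  fixes gd :: "'g \<Rightarrow> 'i::ab_group_add"
    and gw :: "'g \<Rightarrow> 'i \<Rightarrow> complex"
    and S :: "'i set"
  assumes gw_le_1: "cmod (gw g i) \<le> 1"
    and gw_support: "gw g i \<noteq> 0 \<Longrightarrow> i \<in> S \<and> i + gd g \<in> S"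
begin

definition lw :: "'g \<times> bool \<Rightarrow> 'i \<Rightarrow> complex" where
  "lw u i = (if snd u then cnj (gw (fst u) (i - gd (fst u))) else gw (fst u) i)"

text \<open>The rightmost letter acts first, so \<open>u\<close> meets a vector already displaced by
  \<open>ws\<close>. The empty word carries the indicator of \<open>S\<close>, as the unit acts by a
  projection.\<close>

primrec wt :: "('g \<times> bool) list \<Rightarrow> 'i \<Rightarrow> complex" where
  "wt [] i = (if i \<in> S then 1 else 0)"
| "wt (u # ws) i = lw u (i + word_degree gd ws) * wt ws i"

lemma lw_support: "lw u i \<noteq> 0 \<Longrightarrow> i \<in> S \<and> i + letter_degree gd u \<in> S"
  using gw_support[of "fst u" i] gw_support[of "fst u" "i - gd (fst u)"]
  by (auto simp: lw_def letter_degree_def split: if_splits)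

lemma lw_flip: "lw (g, \<not> s) i = cnj (lw (g, s) (i - letter_degree gd (g, s)))"
  by (simp add: lw_def letter_degree_def)

lemma wt_support: "wt ws i \<noteq> 0 \<Longrightarrow> i \<in> S \<and> i + word_degree gd ws \<in> S"
proof (induction ws)
  case (Cons u ws)
  then show ?case using lw_support[of u "i + word_degree gd ws"]
    by (auto simp: word_degree_Cons algebra_simps)
qed (auto simp: word_degree_Nil split: if_splits)

lemma wt_append: "wt (ws @ vs) i = wt ws (i + word_degree gd vs) * wt vs i"
proof (induction ws)
  case Nil
  \<comment> \<open>The empty word contributes the indicator of \<open>S\<close> at the target of
    \<open>vs\<close>, which is \<open>1\<close> whenever the weight of \<open>vs\<close> is
    nonzero.\<close>
  then show ?case using wt_support[of vs i] by auto
qed (simp add: word_degree_append algebra_simps)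

lemma wt_letter: "wt [u] i = lw u i"
  using lw_support[of u i] by (auto simp: word_degree_Nil)

lemma wt_le_1: "cmod (wt ws i) \<le> 1"
proof (induction ws)
  case (Cons u ws)
  have "cmod (lw u (i + word_degree gd ws)) \<le> 1" by (simp add: lw_def gw_le_1)
  then show ?case using Cons by (simp add: norm_mult mult_le_one)
qed simp

lemma word_degree_adj: "word_degree gd (letters (adj_word w)) = - word_degree gd (letters w)"
proof -
  have "word_degree gd (rev (map (\<lambda>(g, s). (g, \<not> s)) ws)) = - word_degree gd ws" for ws
    by (induction ws)
      (auto simp: word_degree_Nil word_degree_append word_degree_Cons letter_degree_def split: if_splits)
  then show ?thesis by (simp add: adj_word_def)
qed

lemma wt_adj: "wt (letters (adj_word w)) i = cnj (wt (letters w) (i - word_degree gd (letters w)))"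
proof -
  have "wt (rev (map (\<lambda>(g, s). (g, \<not> s)) ws)) i = cnj (wt ws (i - word_degree gd ws))" for ws i
  proof (induction ws arbitrary: i)
    case (Cons u ws)
    obtain g s where u: "u = (g, s)" by (cases u)
    have deg: "word_degree gd [(g, \<not> s)] = - letter_degree gd u"
      by (simp add: u word_degree_Cons word_degree_Nil letter_degree_def)
    have "wt [(g, \<not> s)] i = cnj (lw u (i - letter_degree gd u))"
      by (simp only: wt_letter lw_flip u)
    then show ?case
      using Cons[of "i - letter_degree gd u"] wt.simps(2)[of u ws "i - word_degree gd (u # ws)"]
      by (simp add: u wt_append deg[unfolded u] word_degree_Cons[of _ _ ws] algebra_simps del: wt.simps)
  qed (simp add: word_degree_Nil)
  then show ?thesis by (simp add: adj_word_def)
qed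

section \<open>The representation of the free algebra\<close>

definition rep :: "'g free_star_algebra \<Rightarrow> 'i fsupp \<Rightarrow> 'i fsupp" where
  "rep x v = (\<Sum>w\<in>Poly_Mapping.keys x.
     wshift (\<lambda>i. Poly_Mapping.lookup x w * wt (letters w) i) (word_degree gd (letters w)) v)"

lemma rep_superset:
  assumes "finite A" "Poly_Mapping.keys x \<subseteq> A"
  shows "rep x v = (\<Sum>w\<in>A.
     wshift (\<lambda>i. Poly_Mapping.lookup x w * wt (letters w) i) (word_degree gd (letters w)) v)"
  unfolding rep_def
  by (rule sum.mono_neutral_left) (use assms in \<open>auto simp: in_keys_iff intro: fsupp_eqI\<close>)

lemma rep_add: "rep (x + y) v = rep x v + rep y v"
proof -
  let ?A = "Poly_Mapping.keys x \<union> Poly_Mapping.keys y"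
  have A: "finite ?A" "Poly_Mapping.keys x \<subseteq> ?A" "Poly_Mapping.keys y \<subseteq> ?A"
    "Poly_Mapping.keys (x + y) \<subseteq> ?A"
    using keys_add[of x y] by auto
  show ?thesis
    unfolding rep_superset[OF A(1,2)] rep_superset[OF A(1,3)] rep_superset[OF A(1,4)]
      sum.distrib[symmetric]
    by (intro sum.cong fsupp_eqI) (simp_all add: lookup_add algebra_simps)
qed

lemma rep_single:
  "rep (Poly_Mapping.single w c) v = wshift (\<lambda>i. c * wt (letters w) i) (word_degree gd (letters w)) v"
  using rep_superset[of "{w}" "Poly_Mapping.single w c"] by simp

lemma bounded_linear_rep: "bounded_linear (rep x)"
  unfolding rep_def
proof (intro bounded_linear_sum)
  fix w
  have "cmod (Poly_Mapping.lookup x w * wt (letters w) i) \<le> cmod (Poly_Mapping.lookup x w)" for i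
    using mult_left_mono[OF wt_le_1, of "cmod (Poly_Mapping.lookup x w)"] by (simp add: norm_mult)
  then show "bounded_linear
      (wshift (\<lambda>i. Poly_Mapping.lookup x w * wt (letters w) i) (word_degree gd (letters w)))"
    by (rule bounded_linear_wshift)
qed

lemma rep_diff: "rep (x - y) v = rep x v - rep y v"
  using rep_add[of "x - y" y v] by (simp add: algebra_simps)

lemma rep_mult: "rep (x * y) v = rep x (rep y v)"
proof -
  note lin = bounded_linear.linear[OF bounded_linear_rep]
  show ?thesis
  proof (induction x rule: poly_mapping_induct_single)
    case (single w c)
    show ?case
    proof (induction y rule: poly_mapping_induct_single)
      case (single w' c')
      show ?case
        by (simp add: mult_single rep_single wshift_wshift plus_star_word_def word_degree_append
            wt_append mult_ac)
    qed (simp add: rep_add algebra_simps linear_add[OF lin])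
  qed (simp add: rep_add algebra_simps)
qed

lemma rep_adjoint: "rep x v \<bullet> w = v \<bullet> rep (fstar x) w"
  by (induction x rule: poly_mapping_induct_single)
    (simp_all add: rep_add fstar_add inner_add_left inner_add_right rep_single fstar_single
      wshift_adjoint wt_adj word_degree_adj)

lemma coord_rep_monomial:
  "coord (rep (monomial ws) v) i = wt ws (i - word_degree gd ws) * coord v (i - word_degree gd ws)"
  by (simp add: monomial_def rep_single)

lemma coord_rep_scale: "coord (rep (fconst c * x) v) i = c * coord (rep x v) i"
  by (induction x rule: poly_mapping_induct_single)
    (simp_all add: rep_add rep_single fconst_times_single algebra_simps)

lemma norm_rep_scale: "norm (rep (fconst c * x) v) = cmod c * norm (rep x v)"
proof -
  \<comment> \<open>The vector space structure is only real, so a complex scalar is written as a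
    shift with constant weight and displacement zero.\<close>
  have "rep (fconst c * x) v = wshift (\<lambda>_. c) 0 (rep x v)"
    by (rule fsupp_eqI) (simp add: coord_rep_scale)
  then show ?thesis
    unfolding norm_eq_sqrt_inner
    by (cases "c = 0")
      (simp_all add: wshift_inner inner_fsupp_def norm_mult power_mult_distrib real_sqrt_mult
        flip: power2_norm_eq_inner sum_distrib_left)
qed

section \<open>The operator norm as a C*-seminorm\<close>

definition rep_norm :: "'g free_star_algebra \<Rightarrow> real" where
  "rep_norm x = onorm (rep x)"

lemma norm_rep_le: "norm (rep x v) \<le> rep_norm x * norm v"
  unfolding rep_norm_def by (rule onorm[OF bounded_linear_rep])

lemma rep_norm_nonneg: "0 \<le> rep_norm x"
  unfolding rep_norm_def by (rule onorm_pos_le[OF bounded_linear_rep])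

lemma rep_norm_le: "0 \<le> B \<Longrightarrow> (\<And>v. norm (rep x v) \<le> B * norm v) \<Longrightarrow> rep_norm x \<le> B"
  unfolding rep_norm_def by (rule onorm_bound)

lemma rep_norm_mult: "rep_norm (x * y) \<le> rep_norm x * rep_norm y"
proof (rule rep_norm_le)
  fix v
  have "norm (rep (x * y) v) \<le> rep_norm x * norm (rep y v)" unfolding rep_mult by (rule norm_rep_le)
  also have "\<dots> \<le> rep_norm x * (rep_norm y * norm v)"
    by (intro mult_left_mono norm_rep_le rep_norm_nonneg)
  finally show "norm (rep (x * y) v) \<le> rep_norm x * rep_norm y * norm v" by (simp add: mult.assoc)
qed (simp add: rep_norm_nonneg)

text \<open>The squared norm of \<open>rep x v\<close> is the inner product of \<open>v\<close> with
  \<open>rep (fstar x * x) v\<close>, which Cauchy-Schwarz bounds without any completeness.\<close>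

lemma rep_norm_star_le: "(rep_norm x)\<^sup>2 \<le> rep_norm (fstar x * x)"
proof -
  have "rep_norm x \<le> sqrt (rep_norm (fstar x * x))"
  proof (rule rep_norm_le)
    fix v
    have "(norm (rep x v))\<^sup>2 = v \<bullet> rep (fstar x * x) v"
      by (simp add: power2_norm_eq_inner rep_adjoint rep_mult)
    also have "\<dots> \<le> norm v * norm (rep (fstar x * x) v)" by (rule norm_cauchy_schwarz)
    also have "\<dots> \<le> norm v * (rep_norm (fstar x * x) * norm v)"
      by (intro mult_left_mono norm_rep_le norm_ge_zero)
    also have "\<dots> = (sqrt (rep_norm (fstar x * x)) * norm v)\<^sup>2"
      by (simp add: power_mult_distrib rep_norm_nonneg power2_eq_square)
    finally show "norm (rep x v) \<le> sqrt (rep_norm (fstar x * x)) * norm v"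
      by (rule power2_le_imp_le) (simp add: rep_norm_nonneg)
  qed (simp add: rep_norm_nonneg)
  then show ?thesis
    using power_mono[of "rep_norm x" _ 2] by (fastforce simp: rep_norm_nonneg)
qed

lemma rep_norm_fstar: "rep_norm (fstar x) = rep_norm x"
proof -
  have "rep_norm x \<le> rep_norm (fstar x)" for x
  proof -
    have "rep_norm x * rep_norm x \<le> rep_norm (fstar x) * rep_norm x"
      using rep_norm_star_le[of x] rep_norm_mult[of "fstar x" x] by (simp add: power2_eq_square)
    then show ?thesis
      using rep_norm_nonneg[of x] rep_norm_nonneg[of "fstar x"]
      by (cases "rep_norm x = 0") auto
  qed
  from this[of x] this[of "fstar x"] show ?thesis by (simp add: fstar_fstar)
qed

lemma rep_norm_scale: "rep_norm (fconst c * x) = cmod c * rep_norm x"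
proof -
  have le: "rep_norm (fconst c * x) \<le> cmod c * rep_norm x" for c x
  proof (rule rep_norm_le)
    show "norm (rep (fconst c * x) v) \<le> cmod c * rep_norm x * norm v" for v
      using mult_left_mono[OF norm_rep_le, of "cmod c" x v] by (simp add: norm_rep_scale mult.assoc)
  qed (simp add: rep_norm_nonneg)
  show ?thesis
  proof (cases "c = 0")
    case True
    then show ?thesis using le[of c x] rep_norm_nonneg[of "fconst c * x"] by simp
  next
    case False
    then have "rep_norm x \<le> cmod (1 / c) * rep_norm (fconst c * x)"
      using le[of "1 / c" "fconst c * x"] by (simp add: fconst_inverse)
    then have "cmod c * rep_norm x \<le> rep_norm (fconst c * x)"
      using False by (simp add: norm_divide field_simps)
    then show ?thesis using le[of c x] by simp
  qed
qed

lemma cstar_seminorm_rep_norm: "cstar_seminorm rep_norm"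
  unfolding cstar_seminorm_def
proof (intro conjI allI)
  fix x y :: "'g free_star_algebra"
  show "rep_norm (x + y) \<le> rep_norm x + rep_norm y"
    using onorm_triangle[OF bounded_linear_rep bounded_linear_rep, of x y]
    by (simp add: rep_norm_def flip: rep_add)
  show "rep_norm (fstar x * x) = (rep_norm x)\<^sup>2"
    using rep_norm_star_le[of x] rep_norm_mult[of "fstar x" x]
    by (simp add: rep_norm_fstar power2_eq_square)
qed (rule rep_norm_nonneg rep_norm_scale rep_norm_mult)+

section \<open>Matrix entries, arranged by displacement and source\<close>

definition entry :: "'g free_star_algebra \<Rightarrow> 'i \<Rightarrow> 'i \<Rightarrow> complex" where
  "entry x d i = coord (rep x (basis_vector i)) (i + d)"

lemma entry_add: "entry (x + y) d i = entry x d i + entry y d i"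
  by (simp add: entry_def rep_add)

lemma entry_diff: "entry (x - y) d i = entry x d i - entry y d i"
  by (simp add: entry_def rep_diff)

lemma entry_single:
  "entry (Poly_Mapping.single w c) d i
     = (if word_degree gd (letters w) = d then c * wt (letters w) i else 0)"
  by (auto simp: entry_def rep_single coord_basis_vector algebra_simps)

lemma entry_eqI: "rep_norm (x - y) = 0 \<Longrightarrow> entry x d i = entry y d i"
  using norm_rep_le[of "x - y" "basis_vector i"] by (simp add: entry_def rep_diff)

lemma entry_sum: "entry (sum f A) d i = (\<Sum>x\<in>A. entry (f x) d i)"
  by (induction A rule: infinite_finite_induct)
    (simp_all add: entry_add, simp_all add: entry_def rep_def)

lemma entry_scale: "entry (fconst c * x) d i = c * entry x d i"
  by (induction x rule: poly_mapping_induct_single)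
    (auto simp: algebra_simps entry_add entry_single fconst_times_single)

lemma entry_monomial: "entry (monomial ws) d i = (if word_degree gd ws = d then wt ws i else 0)"
  by (simp add: monomial_def entry_single)

text \<open>A letter on the left acts last, at the point where \<open>x\<close> has arrived; in
  \<open>entry_mult_letter\<close> it acts first and moves the source of \<open>x\<close>.\<close>

lemma entry_letter_mult:
  "entry (letter u * x) d i = lw u (i + d - letter_degree gd u) * entry x (d - letter_degree gd u) i"
  by (induction x rule: poly_mapping_induct_single)
    (auto simp: algebra_simps entry_add monomial_def mult_single entry_single plus_star_word_def
      word_degree_Cons)

lemma entry_mult_letter:
  "entry (x * letter u) d i = entry x (d - letter_degree gd u) (i + letter_degree gd u) * lw u i"
proof (induction x rule: poly_mapping_induct_single)
  case (single w c)
  have "word_degree gd [u] = letter_degree gd u" by (simp add: word_degree_Cons word_degree_Nil)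
  then show ?case
    by (auto simp: monomial_def mult_single entry_single plus_star_word_def word_degree_append
        wt_append wt_letter simp del: wt.simps)
qed (simp add: algebra_simps entry_add)

lemma entry_support: "entry x d i \<noteq> 0 \<Longrightarrow> i \<in> S \<and> i + d \<in> S"
proof (induction x rule: poly_mapping_induct_single)
  case (single w c)
  then show ?case using wt_support[of "letters w" i] by (auto simp: entry_single split: if_splits)
next
  case (add x y)
  then show ?case by (cases "entry x d i = 0") (simp_all add: entry_add)
qed

end


section \<open>A faithful representation\<close>

context uq2
begin

text \<open>The eigenvalue of \<open>y\<close> at level \<open>n\<close> is \<open>Q\<^sup>n\<close>.  The levels are the \<open>n\<close> for which both
  \<open>a a\<^sup>* = 1 - Q\<^sup>n\<close> and \<open>a\<^sup>* a = 1 - Q\<^bsup>n+1\<^esup>\<close> are nonnegative; the shift stops at the end of the range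
  because there the weight vanishes.\<close>

definition levels :: "int set" where
  "levels = (if cmod q < 1 then {0..} else {..<0})"

definition indices :: "(int \<times> int \<times> int) set" where
  "indices = {i. fst i \<in> levels}"

lemma mem_indices: "i \<in> indices \<longleftrightarrow> fst i \<in> levels"
  by (simp add: indices_def)

text \<open>The exponent of \<open>lam\<close> encodes the relation for \<open>b * D\<close>: since
  \<open>b\<close> raises the second coordinate, \<open>D\<close> acting after \<open>b\<close>
  yields one factor \<open>1 / lam\<close> more than before it.\<close>

primrec gen_weight :: "uq2_gen \<Rightarrow> int \<times> int \<times> int \<Rightarrow> complex" where
  "gen_weight Gen_a i =
     (if fst i \<in> levels \<and> fst i + 1 \<in> levels then of_real (sqrt (1 - Q powi (fst i + 1))) else 0)"
| "gen_weight Gen_b i = (if fst i \<in> levels then q powi fst i else 0)"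
| "gen_weight Gen_D i = (if fst i \<in> levels then lam powi (- fst (snd i)) else 0)"

lemma Q_pos: "0 < Q" and Q_less_1_iff: "Q < 1 \<longleftrightarrow> cmod q < 1" and Q_not_1: "Q \<noteq> 1"
  using q_nonzero q_norm
  by (simp_all add: Q_def power2_eq_1_iff abs_square_less_1[of "cmod q", simplified])
    (metis norm_ge_zero order_less_le_trans zero_less_one not_less_iff_gr_or_eq neg_less_0_iff_less)

lemma norm_lam: "cmod lam = 1"
  using q_nonzero by (simp add: lam_def norm_divide norm_power)

lemma Q_powi_inj: "Q powi m = Q powi n \<longleftrightarrow> m = n"
proof -
  have "Q powi m \<noteq> Q powi n" if "m < n" for m n
    using power_int_strict_increasing[OF that, of Q] power_int_strict_decreasing[OF that, of Q]
      Q_pos Q_not_1 by (cases "Q < 1") auto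
  then show ?thesis by (metis linorder_neqE)
qed

lemma Q_powi_less_1: "n \<in> levels \<Longrightarrow> n \<noteq> 0 \<Longrightarrow> Q powi n < 1"
  using power_int_strict_increasing[of n 0 Q] power_int_strict_decreasing[of 0 n Q] Q_pos Q_not_1
    Q_less_1_iff by (cases "Q < 1") (auto simp: levels_def)

lemma Q_powi_le_1: "n \<in> levels \<Longrightarrow> Q powi n \<le> 1"
  using Q_powi_less_1[of n] by (cases "n = 0") auto

lemma norm_q_powi: "(cmod (q powi n))\<^sup>2 = Q powi n"
  by (simp add: Q_def norm_power_int power2_eq_square power_int_mult_distrib)

lemma gen_weight_le_1: "cmod (gen_weight g i) \<le> 1"
proof (cases g)
  case Gen_a
  have "\<bar>sqrt (1 - Q powi n)\<bar> \<le> 1" if "n \<in> levels" for n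
    using Q_powi_le_1[OF that] Q_pos by simp
  then show ?thesis by (simp add: Gen_a)
next
  case Gen_b
  have "cmod (q powi n) \<le> 1" if "n \<in> levels" for n
    using Q_powi_le_1[OF that] norm_q_powi[of n] abs_square_le_1[of "cmod (q powi n)"] by simp
  then show ?thesis by (simp add: Gen_b)
next
  case Gen_D
  then show ?thesis by (simp add: norm_power_int norm_lam)
qed

sublocale weighted_shifts gen_degree gen_weight indices
proof
  fix g and i :: "int \<times> int \<times> int"
  show "cmod (gen_weight g i) \<le> 1" by (rule gen_weight_le_1)
  show "gen_weight g i \<noteq> 0 \<Longrightarrow> i \<in> indices \<and> i + gen_degree g \<in> indices"
    by (cases g) (auto simp: mem_indices split: if_splits)
qed

text \<open>At the two possible ends of the range the exponent of \<open>Q\<close> in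
  \<open>1 - Q^n\<close> or \<open>1 - Q^(n + 1)\<close> is \<open>0\<close>, so
  \<open>a * fstar a\<close> and \<open>fstar a * a\<close> keep their values there.\<close>

lemma levels_step:
  "n \<in> levels \<Longrightarrow> n - 1 \<notin> levels \<Longrightarrow> n = 0"
  "n \<in> levels \<Longrightarrow> n + 1 \<notin> levels \<Longrightarrow> n = - 1"
  by (auto simp: levels_def split: if_splits)

lemma sqrt_weight_square:
  assumes "n \<in> levels"
  shows "complex_of_real (sqrt (1 - Q powi n)) * complex_of_real (sqrt (1 - Q powi n))
    = 1 - of_real (Q powi n)"
  using Q_powi_le_1[OF assms] by (simp flip: of_real_mult)

lemma q_powi_cnj: "q powi n * cnj (q powi n) = of_real (Q powi n)"
  using complex_norm_square[of "q powi n"] norm_q_powi[of n] by simp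

lemma rep_relation:
  assumes "r \<in> uq2_relations q"
  shows "rep r v = 0"
proof -
  note word = word_degree_Cons word_degree_Nil letter_degree_def lw_def zero_prod_def mem_indices
  have "coord (rep r v) j = 0" for j
  proof -
    obtain n k l where j: "j = (n, k, l)" by (cases j)
    have two: "letter u * letter w = monomial [u, w]" for u w :: "uq2_gen \<times> bool"
      by (simp add: monomial_append[symmetric])
    \<comment> \<open>The terms of each relation have equal degree, so every coordinate of
      \<open>rep r v\<close> is a combination of weights times a single coordinate of
      \<open>v\<close>.\<close>
    have rels: "uq2_relations q = {
      monomial [(Gen_b, False), (Gen_a, False)] - fconst q * monomial [(Gen_a, False), (Gen_b, False)],
      monomial [(Gen_a, True), (Gen_b, False)] - fconst q * monomial [(Gen_b, False), (Gen_a, True)],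
      monomial [(Gen_b, False), (Gen_b, True)] - monomial [(Gen_b, True), (Gen_b, False)],
      monomial [(Gen_a, False), (Gen_a, True)] + monomial [(Gen_b, False), (Gen_b, True)] - monomial [],
      monomial [(Gen_a, False), (Gen_D, False)] - monomial [(Gen_D, False), (Gen_a, False)],
      monomial [(Gen_b, False), (Gen_D, False)]
        - fconst lam * monomial [(Gen_D, False), (Gen_b, False)],
      monomial [(Gen_D, False), (Gen_D, True)] - monomial [],
      monomial [(Gen_D, True), (Gen_D, False)] - monomial [],
      monomial [(Gen_a, True), (Gen_a, False)]
        + fconst (of_real Q) * monomial [(Gen_b, True), (Gen_b, False)] - monomial []}"
      unfolding uq2_relations_def Let_def lam_def Q_def letter_False[symmetric] fstar_letter
        two monomial_Nil[symmetric] by simp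
    have powers: "q * q powi (n - 1) = q powi n" "q powi (n + 1) = q * q powi n"
      "lam powi (1 - k) = lam * lam powi (- k)"
      using q_nonzero lam_nonzero
      by (simp_all add: power_int_diff power_int_add power_int_minus field_simps)
    have squares: "q powi n * cnj q powi n = of_real Q powi n"
      "cnj q powi n * q powi n = of_real Q powi n"
      using q_powi_cnj[of n] by (simp_all add: mult.commute)
    have "lam powi m * cnj (lam powi m) = 1" for m
      using complex_norm_square[of "lam powi m"] by (simp add: norm_power_int norm_lam)
    then have lam_squares: "lam powi m * cnj lam powi m = 1" "cnj lam powi m * lam powi m = 1" for m
      by (simp_all add: mult.commute)
    have Q_step: "complex_of_real Q * cnj q powi n * q powi n = of_real Q powi (n + 1)"
      using Q_pos squares(2) by (simp add: power_int_add mult.assoc)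
    \<comment> \<open>This is for level \<open>- 1\<close>: there \<open>a\<close> acts as zero and
      the term with \<open>fstar b * b\<close> alone must give \<open>1\<close>.\<close>
    have Q_inverse: "complex_of_real Q * inverse (cnj q) * inverse q = 1"
      using complex_norm_square[of q] q_nonzero by (simp add: Q_def field_simps)
    show ?thesis
      using assms levels_step[of n] unfolding rels
      by (auto simp: j rep_diff rep_add coord_rep_scale coord_rep_monomial word powers squares
          lam_squares Q_step Q_inverse sqrt_weight_square ring_distribs simp flip: mult.assoc)
  qed
  then show ?thesis by (intro fsupp_eqI) simp
qed

lemma rep_norm_in_rel_seminorms: "rep_norm \<in> rel_seminorms (uq2_relations q)"
proof -
  have "rep_norm r = 0" if "r \<in> uq2_relations q" for r
    using rep_norm_le[of 0 r] rep_norm_nonneg[of r] rep_relation[OF that] by simp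
  then show ?thesis by (simp add: rel_seminorms_def cstar_seminorm_rep_norm)
qed

text \<open>As \<open>rep_norm\<close> is among the seminorms of the supremum, entries descend to
  the quotient and can detect inequality and non-commutation.\<close>

lemma entry_eqv: "x \<doteq> z \<Longrightarrow> entry x d i = entry z d i"
  by (rule entry_eqI[OF eqv_seminorm[OF _ rep_norm_in_rel_seminorms]])

text \<open>On basis vectors \<open>y\<close> is diagonal, and what counts is the level
  \<open>fst (i + d)\<close> where \<open>x\<close> ends; a nonzero entry guarantees that it lies in
  \<open>levels\<close>.\<close>

lemma entry_y_mult: "entry (y * x) d i = of_real (Q powi fst (i + d)) * entry x d i"
proof (cases "entry x d i = 0")
  case True
  then show ?thesis by (cases d) (simp add: y_letters mult.assoc entry_letter_mult letter_degree_def)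
next
  case False
  then have level: "fst (i + d) \<in> levels" using entry_support[of x d i] by (simp add: mem_indices)
  have "entry (y * x) d i = (q powi fst (i + d) * cnj (q powi fst (i + d))) * entry x d i"
    using level
    by (cases d; cases i)
      (simp add: y_letters mult.assoc entry_letter_mult letter_degree_def lw_def)
  then show ?thesis by (simp only: q_powi_cnj)
qed

lemma entry_ev_mult: "entry (ev P * x) d i = poly P (of_real (Q powi fst (i + d))) * entry x d i"
proof (induction P)
  case 0
  show ?case by (simp add: entry_def rep_def)
next
  case (pCons c P)
  then show ?case
    by (simp add: ev_pCons distrib_right mult.assoc entry_add entry_scale entry_y_mult)
qed

section \<open>Nonvanishing weights of normal words\<close>

lemma word_degree_spower:
  "word_degree gen_degree (spower Gen_a k) = (k, 0, 0)"
  "word_degree gen_degree (spower Gen_b k) = (0, k, 0)"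
  "word_degree gen_degree (spower Gen_D k) = (0, 0, k)"
proof -
  have "word_degree gen_degree (replicate m (Gen_a, s)) = (if s then - int m else int m, 0, 0)"
    "word_degree gen_degree (replicate m (Gen_b, s)) = (0, if s then - int m else int m, 0)"
    "word_degree gen_degree (replicate m (Gen_D, s)) = (0, 0, if s then - int m else int m)" for m s
    by (induction m)
      (auto simp: word_degree_Cons word_degree_Nil letter_degree_def zero_prod_def)
  then show
    "word_degree gen_degree (spower Gen_a k) = (k, 0, 0)"
    "word_degree gen_degree (spower Gen_b k) = (0, k, 0)"
    "word_degree gen_degree (spower Gen_D k) = (0, 0, k)"
    by (auto simp: spower_def)
qed

lemma word_degree_normal_word: "word_degree gen_degree (normal_word d) = d"
  by (simp add: normal_word_def word_degree_append word_degree_spower)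

lemma levels_between:
  assumes "n \<in> levels" "m \<in> levels" "n \<le> i \<and> i \<le> m \<or> m \<le> i \<and> i \<le> n"
  shows "i \<in> levels"
  using assms by (auto simp: levels_def split: if_splits)

lemma wt_spower_nonzero:
  assumes "g \<noteq> Gen_a" "fst i \<in> levels"
  shows "wt (spower g k) i \<noteq> 0"
proof -
  have "wt (replicate m (g, s)) i \<noteq> 0 \<and> fst (word_degree gen_degree (replicate m (g, s))) = 0" for m s
    using assms q_nonzero lam_nonzero
    by (induction m; cases g; cases s)
      (auto simp: lw_def mem_indices word_degree_Cons word_degree_Nil letter_degree_def)
  then show ?thesis by (simp add: spower_def)
qed

text \<open>As \<open>levels\<close> is an interval, the whole path stays in it; the weights
  \<open>sqrt (1 - Q^n)\<close> vanish only for \<open>n = 0\<close>, which is never the upper end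
  of a step inside \<open>levels\<close>.\<close>

lemma wt_spower_a_nonzero:
  assumes "fst i \<in> levels" "fst i + k \<in> levels"
  shows "wt (spower Gen_a k) i \<noteq> 0"
proof -
  have pos: "sqrt (1 - Q powi n) \<noteq> 0" if "n \<in> levels" "n \<noteq> 0" for n
    using Q_powi_less_1[OF that] by simp
  have nz: "n \<in> levels \<Longrightarrow> n + 1 \<in> levels \<Longrightarrow> n + 1 \<noteq> 0" for n
    by (auto simp: levels_def split: if_splits)
  have "wt (replicate m (Gen_a, s)) i \<noteq> 0"
    if "fst i + (if s then - int m else int m) \<in> levels" for m s
    using that
  proof (induction m)
    case 0
    then show ?case using assms by (simp add: mem_indices)
  next
    case (Suc m)
    let ?n = "fst i + (if s then - int m else int m)"
    have n: "?n \<in> levels"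
      by (rule levels_between[OF assms(1) Suc.prems]) auto
    have deg: "word_degree gen_degree (replicate m (Gen_a, s)) = (if s then - int m else int m, 0, 0)"
      using word_degree_spower(1)[of "if s then - int m else int m"]
      by (cases "m = 0"; cases s) (auto simp: spower_def word_degree_Nil zero_prod_def)
    have "lw (Gen_a, s) (i + word_degree gen_degree (replicate m (Gen_a, s))) \<noteq> 0"
    proof (cases s)
      case True
      from deg True have deg: "word_degree gen_degree (replicate m (Gen_a, True)) = (- int m, 0, 0)"
        by simp
      have eq: "fst i + - int (Suc m) = ?n - 1" using True by simp
      have n1: "?n - 1 \<in> levels" using Suc.prems True unfolding eq[symmetric] by simp
      have "?n \<noteq> 0" using nz[of "?n - 1"] n n1 by simp
      from pos[OF n this] show ?thesis using n n1 True by (simp add: lw_def deg)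
    next
      case False
      from deg False have deg: "word_degree gen_degree (replicate m (Gen_a, False)) = (int m, 0, 0)"
        by simp
      have n1: "?n + 1 \<in> levels" using Suc.prems False by (simp add: algebra_simps)
      from pos[OF n1 nz[OF n n1]] show ?thesis using n n1 False by (simp add: lw_def deg)
    qed
    then show ?case using Suc n by simp
  qed
  from this[of "k < 0" "nat \<bar>k\<bar>"] assms(2) show ?thesis by (auto simp: spower_def)
qed

lemma wt_normal_word_nonzero:
  assumes "fst i \<in> levels" "fst i + fst d \<in> levels"
  shows "wt (normal_word d) i \<noteq> 0"
proof -
  obtain k j l where d: "d = (k, j, l)" by (cases d)
  show ?thesis
    using assms wt_spower_nonzero[of Gen_b "i + ((0, 0, l) + (k, 0, 0))" j]
      wt_spower_nonzero[of Gen_D i l] wt_spower_a_nonzero[of "i + (0, 0, l)" k]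
    by (simp add: d normal_word_def wt_append word_degree_append word_degree_spower add_ac)
qed

lemma poly_eq_0_if_zero_on_levels:
  fixes P :: "complex poly"
  assumes "\<And>n. n \<in> levels \<Longrightarrow> n + k \<in> levels \<Longrightarrow> poly P (of_real (Q powi (n + k))) = 0"
  shows "P = 0"
proof (rule ccontr)
  assume "P \<noteq> 0"
  \<comment> \<open>The offset by the absolute value of \<open>k\<close> keeps both
    \<open>f m\<close> and \<open>f m + k\<close> inside \<open>levels\<close>; as \<open>f\<close>
    is injective, \<open>P\<close> would have infinitely many roots.\<close>
  define f :: "nat \<Rightarrow> int" where
    "f m = (if cmod q < 1 then int m + \<bar>k\<bar> else - 1 - int m - \<bar>k\<bar>)" for m
  have "range (\<lambda>m. complex_of_real (Q powi (f m + k))) \<subseteq> {z. poly P z = 0}"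
    using assms by (auto simp: f_def levels_def)
  then have "finite (range (\<lambda>m. complex_of_real (Q powi (f m + k))))"
    using poly_roots_finite[OF \<open>P \<noteq> 0\<close>] finite_subset by blast
  moreover have "inj (\<lambda>m. complex_of_real (Q powi (f m + k)))"
    by (rule injI) (auto simp: Q_powi_inj f_def simp del: of_real_power_int split: if_splits)
  ultimately show False using finite_imageD infinite_UNIV_nat by blast
qed

text \<open>Different degrees occupy different diagonals, and the entries on diagonal
  \<open>d\<close> are values of one polynomial at infinitely many powers of \<open>Q\<close>, times
  nonzero weights.\<close>

theorem entry_faithful:
  assumes "\<And>d i. entry x d i = 0"
  shows "x \<doteq> 0"
proof -
  let ?deg = "\<lambda>w. word_degree gen_degree (letters w)"
  let ?N = "\<lambda>d. monomial (normal_word d)"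
  let ?c = "Poly_Mapping.lookup x"
  have "\<forall>w. \<exists>P. monomial (letters w) \<doteq> ev P * ?N (?deg w)" using monomial_normal_form by blast
  from choice[OF this] obtain P where P: "monomial (letters w) \<doteq> ev (P w) * ?N (?deg w)" for w
    by blast
  define W where "W d = {w \<in> Poly_Mapping.keys x. ?deg w = d}" for d
  \<comment> \<open>The component of \<open>x\<close> in degree \<open>d\<close> is
    \<open>ev (R d)\<close> times one normal word.\<close>
  define R where "R d = (\<Sum>w\<in>W d. smult (?c w) (P w))" for d
  have x_eq: "x = (\<Sum>w\<in>Poly_Mapping.keys x. fconst (?c w) * monomial (letters w))"
    by (subst poly_mapping_sum_single[of x])
      (simp add: monomial_def fconst_times_single)
  have "R d = 0" for d
  proof (rule poly_eq_0_if_zero_on_levels)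
    fix n assume n: "n \<in> levels" "n + fst d \<in> levels"
    let ?i = "(n, 0, 0)"
    have weight: "entry (monomial (letters w)) d ?i
        = (if ?deg w = d then poly (P w) (of_real (Q powi (n + fst d))) * wt (normal_word d) ?i
           else 0)" for w
      unfolding entry_eqv[OF P[of w]] entry_ev_mult
      by (simp add: entry_monomial word_degree_normal_word)
    have "0 = (\<Sum>w\<in>Poly_Mapping.keys x. ?c w * entry (monomial (letters w)) d ?i)"
      using assms[of d ?i] by (subst (asm) x_eq) (simp add: entry_sum entry_scale)
    also have "\<dots> = (\<Sum>w\<in>W d.
        ?c w * (poly (P w) (of_real (Q powi (n + fst d))) * wt (normal_word d) ?i))"
      unfolding weight W_def by (rule sum.mono_neutral_cong_right) auto
    also have "\<dots> = poly (R d) (of_real (Q powi (n + fst d))) * wt (normal_word d) ?i"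
      by (simp add: R_def poly_sum sum_distrib_right mult.assoc)
    finally show "poly (R d) (of_real (Q powi (n + fst d))) = 0"
      using wt_normal_word_nonzero[of ?i d] n by simp
  qed
  have "x \<doteq> (\<Sum>w\<in>Poly_Mapping.keys x. fconst (?c w) * (ev (P w) * ?N (?deg w)))"
    by (subst x_eq) (intro eqv_sum eqv_mult_left P)
  also have "\<dots> = (\<Sum>d\<in>?deg ` Poly_Mapping.keys x.
      \<Sum>w\<in>W d. fconst (?c w) * (ev (P w) * ?N (?deg w)))"
    unfolding W_def by (rule sum.image_gen) simp
  also have "\<dots> = (\<Sum>d\<in>?deg ` Poly_Mapping.keys x. ev (R d) * ?N d)"
  proof (rule sum.cong[OF refl])
    fix d
    have "(\<Sum>w\<in>W d. fconst (?c w) * (ev (P w) * ?N (?deg w)))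
        = (\<Sum>w\<in>W d. ev (smult (?c w) (P w)) * ?N d)"
      by (rule sum.cong) (simp_all add: W_def ev_smult mult.assoc)
    then show "(\<Sum>w\<in>W d. fconst (?c w) * (ev (P w) * ?N (?deg w))) = ev (R d) * ?N d"
      by (simp add: R_def ev_sum sum_distrib_right)
  qed
  also have "\<dots> = 0" using \<open>\<And>d. R d = 0\<close> by simp
  finally show ?thesis .
qed

end


section \<open>Central elements\<close>

lemma const_if_step_int:
  fixes f :: "int \<Rightarrow> 'a"
  assumes "\<And>n. f (n + 1) = f n"
  shows "f n = f 0"
proof (induction n rule: int_induct[where k = 0])
  case (step2 n)
  then show ?case using assms[of "n - 1"] by simp
qed (simp_all add: assms)

context uq2
begin

section \<open>Dependence of the entries on the source\<close>

lemma wt_shift_D: "wt ws (n, j, l + 1) = wt ws (n, j, l)"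
proof (induction ws)
  case (Cons u ws)
  obtain k' j' l' where deg: "word_degree gen_degree ws = (k', j', l')"
    by (cases "word_degree gen_degree ws")
  obtain g s where u: "u = (g, s)" by (cases u)
  have "lw u (n + k', j + j', l + 1 + l') = lw u (n + k', j + j', l + l')"
    by (cases g) (simp_all add: u lw_def)
  then show ?case using Cons by (simp add: deg)
qed (simp add: mem_indices)

text \<open>Only \<open>D\<close> and \<open>fstar D\<close> see the second coordinate; raising it
  multiplies their weights by \<open>1 / lam\<close> and by \<open>cnj (1 / lam) = lam\<close>, one
  factor for each unit of degree.\<close>

lemma wt_shift_b:
  "wt ws (n, j + 1, l) = lam powi (- snd (snd (word_degree gen_degree ws))) * wt ws (n, j, l)"
proof (induction ws)
  case (Cons u ws)
  obtain k' j' l' where deg: "word_degree gen_degree ws = (k', j', l')"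
    by (cases "word_degree gen_degree ws")
  obtain g s where u: "u = (g, s)" by (cases u)
  have cnj_lam: "cnj lam = inverse lam"
    using complex_norm_square[of lam] norm_lam by (simp add: field_simps lam_nonzero)
  have step: "lw u (n + k', j + 1 + j', l + l')
      = lam powi (- snd (snd (letter_degree gen_degree u))) * lw u (n + k', j + j', l + l')"
    using lam_nonzero
    by (cases g; cases s)
      (simp_all add: u lw_def letter_degree_def cnj_lam power_int_inverse power_int_diff
        power_int_add power_int_minus field_simps)
  have e: "lam powi (- (snd (snd (letter_degree gen_degree u)) + l'))
      = lam powi (- snd (snd (letter_degree gen_degree u))) * lam powi (- l')"
    using lam_nonzero by (simp flip: power_int_add)
  have "wt (u # ws) (n, j + 1, l) = lw u (n + k', j + 1 + j', l + l') * wt ws (n, j + 1, l)"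
    by (simp add: deg)
  also have "\<dots> = lam powi (- (snd (snd (letter_degree gen_degree u)) + l')) * wt (u # ws) (n, j, l)"
    unfolding e step Cons deg by (simp add: deg)
  finally show ?case by (simp add: word_degree_Cons deg)
qed (simp add: mem_indices word_degree_Nil)

lemma entry_shift_D: "entry x d (n, j, l + 1) = entry x d (n, j, l)"
  by (induction x rule: poly_mapping_induct_single) (simp_all add: entry_add entry_single wt_shift_D)

lemma entry_shift_b: "entry x d (n, j + 1, l) = lam powi (- snd (snd d)) * entry x d (n, j, l)"
  by (induction x rule: poly_mapping_induct_single)
    (auto simp: entry_add entry_single wt_shift_b distrib_left mult_ac)

lemma central_entry_degree:
  assumes central: "\<And>z. x * z \<doteq> z * x" and lam: "\<And>n. lam powi n = 1 \<Longrightarrow> n = 0"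
    and nz: "entry x d i \<noteq> 0"
  shows "d = 0"
proof -
  obtain k m l where d: "d = (k, m, l)" by (cases d)
  obtain n j h where i: "i = (n, j, h)" by (cases i)
  have levels: "n \<in> levels" "n + k \<in> levels"
    using entry_support[OF nz] by (simp_all add: d i mem_indices)
  \<comment> \<open>On the left \<open>D\<close> acts first, at second coordinate \<open>j\<close>;
    on the right it acts after \<open>x\<close>, at \<open>j + m\<close>.\<close>
  have "entry (x * letter (Gen_D, False)) (d + (0, 0, 1)) i
      = entry (letter (Gen_D, False) * x) (d + (0, 0, 1)) i"
    by (rule entry_eqv[OF central])
  then have "entry x d i * lam powi (- j) = lam powi (- (j + m)) * entry x d i"
    using levels
    by (simp add: entry_letter_mult entry_mult_letter letter_degree_def lw_def d i entry_shift_D)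
  then have "lam powi (- j) = lam powi (- (j + m))" using nz by simp
  then have "lam powi (j + m) * lam powi (- j) = lam powi (j + m) * lam powi (- (j + m))" by simp
  then have "lam powi m = 1" using lam_nonzero by (simp flip: power_int_add)
  then have m: "m = 0" by (rule lam)
  \<comment> \<open>Acting first, \<open>b\<close> sees level \<open>n\<close> and shifts the source
    of \<open>x\<close>, which costs \<open>lam powi (- l)\<close>; acting last, it sees level
    \<open>n + k\<close>.\<close>
  have "entry (x * letter (Gen_b, False)) (d + (0, 1, 0)) i
      = entry (letter (Gen_b, False) * x) (d + (0, 1, 0)) i"
    by (rule entry_eqv[OF central])
  then have "lam powi (- l) * entry x d i * q powi n = q powi (n + k) * entry x d i"
    using levels
    by (simp add: entry_letter_mult entry_mult_letter letter_degree_def lw_def d i entry_shift_b)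
  then have *: "q powi k = lam powi (- l)" using nz q_nonzero by (simp add: power_int_add)
  have "Q powi k = (cmod (q powi k))\<^sup>2" by (simp add: norm_q_powi)
  also have "\<dots> = Q powi 0" unfolding * by (simp add: norm_power_int norm_lam)
  finally have k: "k = 0" by (simp only: Q_powi_inj)
  with * have "lam powi l = 1" by (simp add: power_int_minus)
  then have "l = 0" by (rule lam)
  with m k show ?thesis by (simp add: d zero_prod_def)
qed

text \<open>In degree zero the factor from shifting by \<open>b\<close> is
  \<open>lam powi 0\<close>, so entries depend only on the level; commuting with \<open>a\<close>
  equates neighbouring levels, the weight between them being nonzero.\<close>

lemma central_entry_0:
  assumes central: "\<And>z. x * z \<doteq> z * x"
  shows "\<exists>c. \<forall>i\<in>indices. entry x 0 i = c"
proof -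
  have horizontal: "entry x 0 (n, j, l) = entry x 0 (n, 0, 0)" for n j l
    using const_if_step_int[of "\<lambda>j. entry x 0 (n, j, l)" j]
      const_if_step_int[of "\<lambda>l. entry x 0 (n, 0, l)" l]
    by (simp add: entry_shift_b entry_shift_D)
  have vertical: "entry x 0 (n + 1, 0, 0) = entry x 0 (n, 0, 0)" if n: "n \<in> levels" "n + 1 \<in> levels" for n
  proof -
    have "n + 1 \<noteq> 0" using n by (auto simp: levels_def split: if_splits)
    then have "sqrt (1 - Q powi (n + 1)) \<noteq> 0" using Q_powi_less_1[of "n + 1"] n by simp
    moreover have "entry (x * letter (Gen_a, False)) (1, 0, 0) (n, 0, 0)
        = entry (letter (Gen_a, False) * x) (1, 0, 0) (n, 0, 0)"
      by (rule entry_eqv[OF central])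
    ultimately show ?thesis
      using n by (simp add: entry_letter_mult entry_mult_letter letter_degree_def lw_def zero_prod_def)
  qed
  \<comment> \<open>The end of the range: induction runs upwards from \<open>0\<close> or downwards
    from \<open>- 1\<close>.\<close>
  define n0 :: int where "n0 = (if cmod q < 1 then 0 else - 1)"
  have "entry x 0 (n, 0, 0) = entry x 0 (n0, 0, 0)" if "n \<in> levels" for n
  proof (cases "cmod q < 1")
    case True
    then have "n \<ge> 0" using that by (simp add: levels_def)
    then show ?thesis
      by (induction n rule: int_ge_induct) (use vertical True in \<open>auto simp: levels_def n0_def\<close>)
  next
    case False
    then have "n \<le> - 1" using that by (simp add: levels_def)
    then show ?thesis
    proof (induction n rule: int_le_induct)
      case (step n)
      then show ?case using vertical[of "n - 1"] False
        by (simp add: levels_def)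
    qed (simp add: n0_def False)
  qed
  then have "entry x 0 (n, j, l) = entry x 0 (n0, 0, 0)" if "n \<in> levels" for n j l
    using horizontal[of n j l] that by simp
  then show ?thesis by (intro exI[of _ "entry x 0 (n0, 0, 0)"]) (simp add: mem_indices split_paired_all)
qed

lemma entry_fconst: "entry (fconst c) d i = (if d = 0 \<and> i \<in> indices then c else 0)"
  by (simp add: fconst_def entry_single zero_star_word_def word_degree_Nil)

text \<open>Subtracting the constant value on the zero diagonal kills every entry, and
  \<open>entry_faithful\<close> applies.\<close>

lemma central_scalar:
  assumes central: "\<And>z. x * z \<doteq> z * x" and lam: "\<And>n. lam powi n = 1 \<Longrightarrow> n = 0"
  shows "\<exists>c. x \<doteq> fconst c"
proof -
  obtain c where c: "entry x 0 i = c" if "i \<in> indices" for i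
    using central_entry_0[OF central] by blast
  have "x - fconst c \<doteq> 0"
  proof (rule entry_faithful)
    fix d i
    show "entry (x - fconst c) d i = 0"
      using c[of i] central_entry_degree[OF central lam, of d i] entry_support[of x d i]
      by (cases "entry x d i = 0") (auto simp: entry_diff entry_fconst)
  qed
  then show ?thesis by (intro exI[of _ c]) (simp add: eqv_def)
qed

section \<open>Transfer to \<open>O_Uq2\<close>\<close>

lemma univ_gen_eq_emb: "univ_gen (uq2_relations q) g = emb (fgen g)"
  by (simp add: univ_gen_def emb_def)

lemma carrier_O: "carrier (O_Uq2 q) = range emb"
proof -
  let ?G = "{univ_gen (uq2_relations q) Gen_a, univ_gen (uq2_relations q) Gen_b,
    univ_gen (uq2_relations q) Gen_D}"
  have "range emb \<subseteq> S" if "star_subalgebra univ_alg S" "?G \<subseteq> S" for S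
  proof (rule range_emb_subset[OF that(1)])
    show "emb (fgen g) \<in> S" for g using that(2) by (cases g) (auto simp: univ_gen_eq_emb)
  qed
  moreover have "?G \<subseteq> range emb" by (auto simp: univ_gen_eq_emb)
  ultimately have "\<Inter>{S. star_subalgebra univ_alg S \<and> ?G \<subseteq> S} = range emb"
    using star_subalgebra_range_emb by blast
  then show ?thesis
    by (simp add: O_Uq2_def generated_star_subalgebra_def C_Uq2_def)
qed

text \<open>As the carrier is the image of \<open>emb\<close>, commutation need only be tested on
  free elements, where \<open>emb_eq_iff\<close> applies.\<close>

lemma center_O: "algebra_center (O_Uq2 q) = emb ` {x. \<forall>z. x * z \<doteq> z * x}"
proof -
  have "emb x \<otimes>\<^bsub>O_Uq2 q\<^esub> emb z = emb (x * z)" for x z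
    using emb_mult by (simp add: O_Uq2_def generated_star_subalgebra_def C_Uq2_def)
  then have comm: "(\<forall>u\<in>range emb. emb x \<otimes>\<^bsub>O_Uq2 q\<^esub> u = u \<otimes>\<^bsub>O_Uq2 q\<^esub> emb x)
      \<longleftrightarrow> (\<forall>z. x * z \<doteq> z * x)" for x
    by (simp add: emb_eq_iff)
  have "{u \<in> range emb. P u} = emb ` {x. P (emb x)}" for P by blast
  then show ?thesis unfolding algebra_center_def carrier_O by (simp only: comm)
qed

lemma scalars_O: "algebra_scalars (O_Uq2 q) = emb ` range fconst"
proof -
  have "scale (O_Uq2 q) c \<one>\<^bsub>O_Uq2 q\<^esub> = emb (fconst c)" for c
    using emb_scale[of c 1] emb_one
    by (simp add: O_Uq2_def generated_star_subalgebra_def C_Uq2_def)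
  then show ?thesis unfolding algebra_scalars_def by auto
qed

lemma scalars_subset_center: "algebra_scalars (O_Uq2 q) \<subseteq> algebra_center (O_Uq2 q)"
  unfolding scalars_O center_O by (auto simp: fconst_commute)

section \<open>The central element \<open>D\<close> for real \<open>q\<close>\<close>

lemma D_central:
  assumes "lam = 1"
  shows "D * x \<doteq> x * D"
proof -
  have a: "comm_by 1 a D" using relations(5) by (simp add: comm_by_def fconst_one)
  have b: "comm_by 1 b D" using relations(6) assms by (simp add: comm_by_def fconst_one)
  have D: "comm_by 1 D D" by (simp add: comm_by_def fconst_one)
  have comm_gen: "comm_by 1 D (fgen g)" for g
    using a b D comm_by_sym[of 1] by (cases g) simp_all
  \<comment> \<open>Unitarity passes commutation with \<open>fgen g\<close> from \<open>D\<close> to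
    \<open>fstar D\<close>; taking adjoints then gives commutation of \<open>D\<close> with
    \<open>fstar (fgen g)\<close>.\<close>
  have comm_star_gen: "comm_by 1 D (fstar (fgen g))" for g
    using comm_by_fstar[OF comm_by_unitary[OF comm_gen[of g] _ relations(7,8)]] comm_by_sym[of 1]
    by (simp add: fstar_fstar)
  have "comm_by 1 D x"
  proof (induction x rule: free_star_algebra_induct)
    case one
    show ?case by (simp add: comm_by_def fconst_one)
  next
    case (gen g x)
    show ?case using comm_by_mult[OF comm_gen[of g] gen] by simp
  next
    case (star_gen g x)
    show ?case using comm_by_mult[OF comm_star_gen[of g] star_gen] by simp
  next
    case (add x z)
    then show ?case using eqv_add[of "D * x" "x * D" "D * z" "z * D"]
      by (simp add: comm_by_def fconst_one algebra_simps)
  next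
    case (scale c x)
    then show ?case using eqv_mult_left[of "D * x" "x * D" "fconst c"]
      by (simp add: comm_by_def fconst_one mult.assoc fconst_left_commute[of D])
  qed
  then show ?thesis by (simp add: comm_by_def fconst_one)
qed

text \<open>\<open>D\<close> displaces the third coordinate, where scalars have zero entry; at
  second coordinate \<open>0\<close> its weight is \<open>lam powi 0 = 1\<close>.\<close>

lemma D_not_scalar: "\<not> D \<doteq> fconst c"
proof
  assume "D \<doteq> fconst c"
  define n :: int where "n = (if cmod q < 1 then 0 else - 1)"
  have n: "n \<in> levels" by (simp add: n_def levels_def)
  have "entry D (0, 0, 1) (n, 0, 0) = entry (letter (Gen_D, False) * fconst 1) (0, 0, 1) (n, 0, 0)"
    by (simp add: letter_False fconst_one)
  also have "\<dots> = 1"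
    using n
    by (simp add: entry_letter_mult letter_degree_def lw_def entry_fconst mem_indices
        zero_prod_def)
  finally show False
    using entry_eqv[OF \<open>D \<doteq> fconst c\<close>, of "(0, 0, 1)" "(n, 0, 0)"]
    by (simp add: entry_fconst zero_prod_def)
qed

end

text \<open>The base is \<open>cis (2 * Arg q)\<close>, so the equation forces
  \<open>n * Arg q\<close> to be an integral multiple of \<open>pi\<close>, which for nonzero
  \<open>n\<close> makes \<open>Arg q / pi\<close> rational.\<close>

lemma powi_arg_square_eq_1:
  fixes q :: complex
  assumes "q \<noteq> 0" and irrational: "Arg q / pi \<notin> \<rat>"
    and eq: "(q\<^sup>2 / of_real ((cmod q)\<^sup>2)) powi n = 1"
  shows "n = 0"
proof (rule ccontr)
  assume "n \<noteq> 0"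
  have "q\<^sup>2 / of_real ((cmod q)\<^sup>2) = (sgn q)\<^sup>2"
    by (simp add: sgn_eq power_divide)
  also have "\<dots> = cis (2 * Arg q)"
    unfolding cis_Arg[OF assms(1), symmetric]
    using cis_mult[of "Arg q" "Arg q"] by (simp add: power2_eq_square)
  finally have "cis (of_int n * (2 * Arg q)) = 1"
    using eq by (simp add: cis_power_int)
  then have "exp (\<i> * of_real (of_int n * (2 * Arg q))) = 1" by (simp add: cis_conv_exp)
  then obtain m :: int where "of_int n * (2 * Arg q) = of_int (2 * m) * pi"
    by (auto simp: exp_eq_1)
  then have "Arg q / pi = of_int m / of_int n"
    using \<open>n \<noteq> 0\<close> by (simp add: field_simps)
  then show False using irrational by simp
qed

theorem corollary3p3:
  fixes q :: complex
  assumes "q \<noteq> 0" and "cmod q \<noteq> 1"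
  shows "(q \<notin> \<real> \<and> Arg q / pi \<notin> \<rat> \<longrightarrow>
            algebra_center (O_Uq2 q) = algebra_scalars (O_Uq2 q)) \<and>
         (q \<in> \<real> \<longrightarrow>
            algebra_scalars (O_Uq2 q) \<subset> algebra_center (O_Uq2 q))"
proof -
  interpret uq2 q by standard (fact assms)+
  show ?thesis
  proof (intro conjI impI)
    assume "q \<notin> \<real> \<and> Arg q / pi \<notin> \<rat>"
    then have "n = 0" if "lam powi n = 1" for n
      using powi_arg_square_eq_1[OF assms(1)] that by (simp add: lam_def)
    then have "algebra_center (O_Uq2 q) \<subseteq> algebra_scalars (O_Uq2 q)"
      using central_scalar by (fastforce simp: center_O scalars_O image_iff emb_eq_iff)
    then show "algebra_center (O_Uq2 q) = algebra_scalars (O_Uq2 q)"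
      using scalars_subset_center by blast
  next
    assume "q \<in> \<real>"
    then obtain r where "q = of_real r" by (auto elim: Reals_cases)
    then have "lam = 1" unfolding lam_def using assms(1) by (simp flip: of_real_power)
    then have "emb D \<in> algebra_center (O_Uq2 q)" by (simp add: center_O D_central)
    moreover have "emb D \<notin> algebra_scalars (O_Uq2 q)"
      using D_not_scalar by (auto simp: scalars_O emb_eq_iff)
    ultimately show "algebra_scalars (O_Uq2 q) \<subset> algebra_center (O_Uq2 q)"
      using scalars_subset_center by blast
  qed
qed

end
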